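(* For $E>0$, \[ \min_{\varphi\in L^2_{p,n}([-\pi,\pi])}\{\Delta_\varphi^2(\cos Q,\sin Q):\Delta_\varphi^2P\le E\}=\max_{s>0}\Big(1-\Big(sE-\frac{s\,a_0(2/s)}{4}\Big)^2\Big). \] The minimum is realized by $\varphi$ if and only if $\varphi$ is given as a shift of the Mathieu function $\theta\mapsto\mathrm{ce}_0(\theta/2,-2/s_E)$, where $s_E=\mathrm{argmax}_{s>0}\big(\frac{s\,a_0(2/s)}{4}+1-sE\big)$.
   Context: $L^2_p([-\pi,\pi])$ is the space of $2\pi$-periodic square-integrable functions with inner product $\int_{-\pi}^{\pi}\bar\varphi\psi\,\frac{d\theta}{2\pi}$; $L^2_{p,n}$ its unit vectors. $Q$ is multiplication by $\theta$ (so $\cos Q,\sin Q$ are multiplication by $\cos\theta,\sin\theta$), $P=-i\,d/d\theta$. For an operator $X$, $\Delta_\varphi^2X=\langle\varphi|(X-\langle\varphi|X|\varphi\rangle)^2|\varphi\rangle$, and $\Delta_\varphi^2(\cos Q,\sin Q):=\Delta_\varphi^2\cos Q+\Delta_\varphi^2\sin Q=1-\langle\varphi|\cos Q|\varphi\rangle^2-\langle\varphi|\sin Q|\varphi\rangle^2$. For real $q$, $a_0(q)$ is the smallest eigenvalue of $-\frac{d^2}{dx^2}+2q\cos2x$ on even $\pi$-periodic functions (smallest characteristic value of Mathieu's equation $y''+(a-2q\cos2x)y=0$ with even $\pi$-periodic solution), and $\mathrm{ce}_0(\cdot,q)$ a corresponding eigenfunction.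
   Formalization: "Shift" is taken to include, besides translation in θ, multiplication by a constant (global phase/normalization) and by e^{ikθ} with integer k; both variances are unchanged by these, so with translations alone the "only if" would be false. *)

theory Defs
  imports "HOL-Analysis.Analysis"
begin

definition L2p :: "(real \<Rightarrow> complex) \<Rightarrow> bool" where
  "L2p \<phi> \<longleftrightarrow> set_borel_measurable lebesgue {-pi..pi} \<phi> \<and>
     set_integrable lebesgue {-pi..pi} (\<lambda>t. (cmod (\<phi> t))\<^sup>2)"

definition ip :: "(real \<Rightarrow> complex) \<Rightarrow> (real \<Rightarrow> complex) \<Rightarrow> complex" where
  "ip \<phi> \<psi> = (LINT t:{-pi..pi}|lebesgue. cnj (\<phi> t) * \<psi> t) / complex_of_real (2 * pi)"

definition unit_state :: "(real \<Rightarrow> complex) \<Rightarrow> bool" where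
  "unit_state \<phi> \<longleftrightarrow> L2p \<phi> \<and> ip \<phi> \<phi> = 1"

definition expect_mult :: "(real \<Rightarrow> real) \<Rightarrow> (real \<Rightarrow> complex) \<Rightarrow> real" where
  "expect_mult f \<phi> = (LINT t:{-pi..pi}|lebesgue. f t * (cmod (\<phi> t))\<^sup>2) / (2 * pi)"

definition var_mult :: "(real \<Rightarrow> real) \<Rightarrow> (real \<Rightarrow> complex) \<Rightarrow> real" where
  "var_mult f \<phi> = (LINT t:{-pi..pi}|lebesgue.
      (f t - expect_mult f \<phi>)\<^sup>2 * (cmod (\<phi> t))\<^sup>2) / (2 * pi)"

definition var_cos_sin :: "(real \<Rightarrow> complex) \<Rightarrow> real" where
  "var_cos_sin \<phi> = var_mult cos \<phi> + var_mult sin \<phi>"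

(* phi lies in the (form) domain of P = -i d/dtheta on periodic functions, with weak
   derivative g: phi is a.e. on [-pi,pi] equal to an absolutely continuous function
   c + int_{-pi}^t g with g in L^2 and periodic boundary condition int_{-pi}^{pi} g = 0 *)
definition deriv_rep :: "(real \<Rightarrow> complex) \<Rightarrow> (real \<Rightarrow> complex) \<Rightarrow> bool" where
  "deriv_rep \<phi> g \<longleftrightarrow> L2p g \<and> (LINT u:{-pi..pi}|lebesgue. g u) = 0 \<and>
     (\<exists>c. AE t in lebesgue. t \<in> {-pi..pi} \<longrightarrow> \<phi> t = c + (LINT u:{-pi..t}|lebesgue. g u))"

(* Delta^2_phi P = || (P - <P>) phi ||^2, where P phi = -i g *)
definition momentum_var :: "(real \<Rightarrow> complex) \<Rightarrow> (real \<Rightarrow> complex) \<Rightarrow> real" where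
  "momentum_var \<phi> g =
     (let p = Re (ip \<phi> (\<lambda>t. - \<i> * g t))
      in (LINT t:{-pi..pi}|lebesgue. (cmod (- \<i> * g t - complex_of_real p * \<phi> t))\<^sup>2) / (2 * pi))"

definition feasible :: "real \<Rightarrow> (real \<Rightarrow> complex) \<Rightarrow> bool" where
  "feasible E \<phi> \<longleftrightarrow> unit_state \<phi> \<and> (\<exists>g. deriv_rep \<phi> g \<and> momentum_var \<phi> g \<le> E)"

definition mathieu_even_sol :: "real \<Rightarrow> real \<Rightarrow> (real \<Rightarrow> real) \<Rightarrow> bool" where
  "mathieu_even_sol a q y \<longleftrightarrow>
     (\<exists>y1 y2. \<forall>x. (y has_real_derivative y1 x) (at x) \<and> (y1 has_real_derivative y2 x) (at x) \<and>
                 y2 x + (a - 2 * q * cos (2 * x)) * y x = 0) \<and>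
     (\<forall>x. y (- x) = y x) \<and> (\<forall>x. y (x + pi) = y x) \<and> (\<exists>x. y x \<noteq> 0)"

definition mathieu_a0 :: "real \<Rightarrow> real" where
  "mathieu_a0 q = Inf {a. \<exists>y. mathieu_even_sol a q y}"

definition bound_fun :: "real \<Rightarrow> real \<Rightarrow> real" where
  "bound_fun E s = 1 - (s * E - s * mathieu_a0 (2 / s) / 4)\<^sup>2"

definition sE_fun :: "real \<Rightarrow> real \<Rightarrow> real" where
  "sE_fun E s = s * mathieu_a0 (2 / s) / 4 + 1 - s * E"

end

theory Submission
  imports Defs
begin

text \<open>
  By the Ritz principle, \<open>energy s = s a0(2/s) / 4\<close> is the minimum of \<open>s <P\<^sup>2> - <cos Q>\<close>, so it is
  concave in \<open>s\<close> and the theorem is Legendre duality. Existence, uniqueness and minimality of the ground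
  state all come from its logarithmic derivative \<open>v\<close>, which solves the Riccati equation
  \<open>s (- v' - v\<^sup>2) = energy s + cos\<close>: for every periodic \<open>v\<close> and every real \<open>p\<close>,
  \<open>\<integral> |\<phi>' - i p \<phi>|\<^sup>2 = \<integral> (- v' - v\<^sup>2) |\<phi>|\<^sup>2 + \<integral> |\<phi>' - (i p + v) \<phi>|\<^sup>2\<close>.
  With the Riccati solution, the last term vanishes only for \<open>\<phi> = c e\<^sup>i\<^sup>p\<^sup>\<theta> exp (\<integral> v)\<close>, and periodicity
  makes \<open>p\<close> an integer; with a first-order perturbation of \<open>v\<close>, the identity shows that \<open>energy\<close> is
  differentiable with derivative the kinetic energy of the ground state, so the maximiser of
  \<open>energy s - s E\<close> has kinetic energy exactly \<open>E\<close>. The solution \<open>v\<close> is found by shooting in the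
  eigenvalue parameter for the Pruefer angle.
\<close>

section \<open>The periodic Riccati equation\<close>

text \<open>Two invariances shape the estimate. A rotation by \<open>a\<close> turns the vector of
  means of \<open>cos\<close> and \<open>sin\<close> onto the cosine axis, so
  \<open>1 - var_cos_sin\<close> becomes the square of a single mean of \<open>cos (t - a)\<close>.
  Centring the momentum brings in its mean \<open>p\<close>, an arbitrary real number; unless it is
  an integer, a factor \<open>cis (- p * t)\<close> destroys periodicity, so \<open>p\<close> cannot
  be gauged away beforehand. The weak identity carries it along, and integrality emerges only in the
  equality case. For the same reason a shift of the Mathieu function means here a translation
  combined with an integer boost \<open>cis (k * t)\<close>, up to a constant factor. The duality
  needs a maximiser inside \<open>s > 0\<close>. It exists because \<open>energy\<close> starts at
  \<open>-1\<close> with infinite slope and never exceeds \<open>0\<close>: the former is seen from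
  the trial functions \<open>(1 + cos)^m\<close> and the lower bounds belonging to
  \<open>exp (k * cos)\<close>, the latter from constants. Finally \<open>s * E - energy s\<close>
  is positive for all \<open>s > 0\<close>, so squaring preserves its minimum and turns it into the
  maximum of \<open>bound_fun\<close>.\<close>

lemma antiderivative_exists:
  fixes f :: "real \<Rightarrow> real"
  assumes "continuous_on UNIV f"
  shows "\<exists>F. F 0 = 0 \<and> (\<forall>x. (F has_real_derivative f x) (at x))"
proof -
  obtain F where F: "\<And>x. (F has_vector_derivative f x) (at x)"
    using einterval_antiderivative[of "-\<infinity>" "\<infinity>" f] assms
    by (auto simp: continuous_on_eq_continuous_at)
  have "((\<lambda>x. F x - F 0) has_real_derivative f x) (at x)" for x
    using F[of x] by (auto simp: has_real_derivative_iff_has_vector_derivative intro!: derivative_eq_intros)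
  then show ?thesis by (intro exI[of _ "\<lambda>x. F x - F 0"]) simp
qed

lemma nondecreasing_if_deriv_nonneg:
  fixes f f' :: "real \<Rightarrow> real"
  assumes "\<And>x. (f has_real_derivative f' x) (at x)" "\<And>x. f' x \<ge> 0" "x \<le> y"
  shows "f x \<le> f y"
  using DERIV_nonneg_imp_nondecreasing[OF assms(3), of f] assms(1,2) by blast

lemma constant_if_deriv_zero:
  fixes f :: "real \<Rightarrow> real"
  assumes "\<And>x. (f has_real_derivative 0) (at x)"
  shows "f x = f y"
  using assms by (metis DERIV_isconst_all)

lemma same_deriv_diff_constant:
  fixes f g h :: "real \<Rightarrow> real"
  assumes "\<And>x. (f has_real_derivative h x) (at x)" "\<And>x. (g has_real_derivative h x) (at x)"
  shows "f x - g x = f y - g y"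
proof (rule constant_if_deriv_zero[of "\<lambda>x. f x - g x"])
  show "((\<lambda>x. f x - g x) has_real_derivative 0) (at x)" for x
    using DERIV_diff[OF assms(1)[of x] assms(2)[of x]] by simp
qed

text \<open>The rate \<open>2 * L\<close> of the weight beats the factor \<open>L\<close> of a
  Lipschitz bound: \<open>L * c * cosh (2 * L * x)\<close> integrates to
  \<open>c / 2 * sinh (2 * L * x)\<close>, whence the contraction constant 1/2. Since
  \<open>cosh\<close> is even, both directions are covered at once.\<close>

lemma abs_le_cosh_weight:
  fixes D D' :: "real \<Rightarrow> real"
  assumes D: "\<And>x. (D has_real_derivative D' x) (at x)" and D0: "D 0 = 0"
    and bnd: "\<And>x. \<bar>D' x\<bar> \<le> L * c * cosh (2 * L * x)" and L: "L > 0"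
  shows "\<bar>D x\<bar> \<le> c / 2 * cosh (2 * L * x)"
proof -
  have c: "0 \<le> c"
  proof -
    have "0 \<le> L * c" using bnd[of 0] by simp
    then show ?thesis using L by (simp add: zero_le_mult_iff)
  qed
  have m1: "c / 2 * sinh (2 * L * y) - D y \<le> c / 2 * sinh (2 * L * z) - D z" if "y \<le> z" for y z
  proof (rule nondecreasing_if_deriv_nonneg[OF _ _ that])
    show "((\<lambda>z. c / 2 * sinh (2 * L * z) - D z) has_real_derivative L * c * cosh (2 * L * x) - D' x) (at x)" for x
      by (auto intro!: derivative_eq_intros D)
    show "L * c * cosh (2 * L * x) - D' x \<ge> 0" for x using bnd[of x] by linarith
  qed
  have m2: "c / 2 * sinh (2 * L * y) + D y \<le> c / 2 * sinh (2 * L * z) + D z" if "y \<le> z" for y z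
  proof (rule nondecreasing_if_deriv_nonneg[OF _ _ that])
    show "((\<lambda>z. c / 2 * sinh (2 * L * z) + D z) has_real_derivative L * c * cosh (2 * L * x) + D' x) (at x)" for x
      by (auto intro!: derivative_eq_intros D)
    show "L * c * cosh (2 * L * x) + D' x \<ge> 0" for x using bnd[of x] by linarith
  qed
  have "\<bar>D x\<bar> \<le> c / 2 * \<bar>sinh (2 * L * x)\<bar>"
  proof (cases "0 \<le> x")
    case True
    then have "sinh (2 * L * x) \<ge> 0" using L by simp
    then show ?thesis using m1[of 0 x] m2[of 0 x] D0 True by (simp add: abs_if)
  next
    case False
    then have "sinh (2 * L * x) < 0" using L by (simp add: mult_pos_neg)
    then show ?thesis using m1[of x 0] m2[of x 0] D0 False by (simp add: abs_if)
  qed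
  also have "\<dots> \<le> c / 2 * cosh (2 * L * x)"
  proof -
    have "\<bar>sinh y\<bar> \<le> cosh y" for y :: real
      using sinh_less_cosh_real[of y] sinh_less_cosh_real[of "-y"] by (auto simp: abs_if)
    then show ?thesis using c by (intro mult_left_mono) auto
  qed
  finally show ?thesis .
qed

text \<open>Picard iteration is a contraction on all of \<open>\<real>\<close> at once in the sup norm with weight
  \<open>1 / cosh (2 L x)\<close>.\<close>

lemma global_ODE_solution:
  fixes F :: "real \<Rightarrow> real \<Rightarrow> real"
  assumes cont: "continuous_on UNIV (\<lambda>(x, y). F x y)"
    and bnd: "\<And>x y. \<bar>F x y\<bar> \<le> M"
    and lip: "\<And>x y z. \<bar>F x y - F x z\<bar> \<le> L * \<bar>y - z\<bar>" and L: "L > 0"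
  shows "\<exists>z. z 0 = 0 \<and> (\<forall>x. (z has_real_derivative F x (z x)) (at x))"
proof -
  define w where "w x = cosh (2 * L * x)" for x
  have w_pos: "w x > 0" for x unfolding w_def by simp
  have w_ge1: "w x \<ge> 1" for x unfolding w_def by (rule cosh_real_ge_1)
  have w_cont [continuous_intros]: "continuous_on S w" for S unfolding w_def by (intro continuous_intros)
  \<comment> \<open>Functions are stored divided by \<open>w\<close>: for \<open>z = w * h\<close>
    the weighted sup norm of \<open>z\<close> is the norm of \<open>h\<close> in the complete space
    of bounded continuous functions.\<close>
  define g where "g h t = F t (w t * apply_bcontfun h t)" for h :: "real \<Rightarrow>\<^sub>C real" and t
  have g_cont: "continuous_on UNIV (g h)" for h
  proof -
    have "continuous_on UNIV (\<lambda>t. (\<lambda>(x, y). F x y) (t, w t * apply_bcontfun h t))"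
      by (rule continuous_on_compose2[OF cont]) (auto intro!: continuous_intros)
    then show ?thesis unfolding g_def by simp
  qed
  obtain A where A0: "A h 0 = 0" and A: "\<And>x. (A h has_real_derivative g h x) (at x)" for h
    using antiderivative_exists[OF g_cont] by metis
  have M: "M \<ge> 0" using bnd[of 0 0] by linarith
  have A_bnd: "\<bar>A h x\<bar> \<le> M / L / 2 * w x" for h x
    unfolding w_def
  proof (rule abs_le_cosh_weight[OF A A0 _ L])
    fix x
    have "M * 1 \<le> M * cosh (2 * L * x)" using M by (intro mult_left_mono cosh_real_ge_1) auto
    then show "\<bar>g h x\<bar> \<le> L * (M / L) * cosh (2 * L * x)"
      using bnd[of x "w x * apply_bcontfun h x"] L unfolding g_def by simp
  qed
  define T where "T h = Bcontfun (\<lambda>x. A h x / w x)" for h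
  have A_cont: "continuous_on UNIV (A h)" for h
    by (meson A DERIV_isCont continuous_at_imp_continuous_on)
  have T: "apply_bcontfun (T h) x = A h x / w x" for h x
  proof -
    have "(\<lambda>x. A h x / w x) \<in> bcontfun"
    proof (rule bcontfun_normI[where b = "M / L / 2"])
      show "continuous_on UNIV (\<lambda>x. A h x / w x)"
        using w_pos by (intro continuous_intros A_cont) (auto simp: less_imp_neq[THEN not_sym])
      show "norm (A h x / w x) \<le> M / L / 2" for x
        using A_bnd[of h x] w_pos[of x] by (simp add: pos_divide_le_eq)
    qed
    then show ?thesis unfolding T_def by (simp add: Bcontfun_inverse)
  qed
  have contr: "dist (T h) (T k) \<le> (1/2) * dist h k" for h k
  proof (rule dist_bound)
    fix x
    have "\<bar>A h x - A k x\<bar> \<le> dist h k / 2 * w x"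
      unfolding w_def
    proof (rule abs_le_cosh_weight[OF _ _ _ L, where D = "\<lambda>x. A h x - A k x"])
      show "((\<lambda>x. A h x - A k x) has_real_derivative g h x - g k x) (at x)" for x
        by (intro derivative_intros A)
      show "A h 0 - A k 0 = 0" using A0 by simp
      fix x
      have "\<bar>g h x - g k x\<bar> \<le> L * \<bar>w x * apply_bcontfun h x - w x * apply_bcontfun k x\<bar>"
        unfolding g_def by (rule lip)
      also have "\<dots> = L * (w x * \<bar>apply_bcontfun h x - apply_bcontfun k x\<bar>)"
        using w_pos[of x] by (simp add: abs_mult flip: right_diff_distrib)
      also have "\<dots> \<le> L * (w x * dist h k)"
        using L w_pos[of x] dist_bounded[of h x k]
        by (intro mult_left_mono) (auto simp: dist_real_def)
      finally show "\<bar>g h x - g k x\<bar> \<le> L * dist h k * cosh (2 * L * x)"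
        by (simp add: w_def mult_ac)
    qed
    then show "dist (apply_bcontfun (T h) x) (apply_bcontfun (T k) x) \<le> (1/2) * dist h k"
      using w_pos[of x] unfolding T dist_real_def by (simp add: divide_simps abs_if split: if_splits)
  qed
  obtain h where h: "T h = h"
    using banach_fix_type[of "1/2" T] contr by auto
  have "w x * apply_bcontfun h x = A h x" for x
    using T[of h x] w_pos[of x] h by (simp add: field_simps)
  then have "g h x = F x (A h x)" for x unfolding g_def by simp
  then show ?thesis using A[of h] A0[of h] by metis
qed

text \<open>A Gronwall estimate for the square of the difference, which, unlike the absolute value,
  is differentiable everywhere. The inhomogeneity enters through
  \<open>2 * |y - z| * d \<le> (y - z)^2 + d^2\<close>; this accounts for the added
  \<open>d^2\<close> and for the \<open>+ 1\<close> in the exponent.\<close>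

lemma diff_square_growth:
  fixes y z :: "real \<Rightarrow> real"
  assumes y: "\<And>x. (y has_real_derivative y' x) (at x)" and z: "\<And>x. (z has_real_derivative z' x) (at x)"
    and b: "\<And>x. \<bar>y' x - z' x\<bar> \<le> L * \<bar>y x - z x\<bar> + d" and "L \<ge> 0" and "x0 \<le> x"
  shows "((y x - z x)\<^sup>2 + d\<^sup>2) * exp (- ((2 * L + 1) * x)) \<le> ((y x0 - z x0)\<^sup>2 + d\<^sup>2) * exp (- ((2 * L + 1) * x0))"
proof -
  define C where "C = 2 * L + 1"
  have L: "L * \<bar>y x - z x\<bar> * 2 * \<bar>y x - z x\<bar> = 2 * L * (y x - z x)\<^sup>2" for x
    by (simp add: power2_eq_square)
  have "- (((y x0 - z x0)\<^sup>2 + d\<^sup>2) * exp (- (C * x0))) \<le> - (((y x - z x)\<^sup>2 + d\<^sup>2) * exp (- (C * x)))"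
  proof (rule nondecreasing_if_deriv_nonneg[OF _ _ \<open>x0 \<le> x\<close>])
    fix x
    show "((\<lambda>x. - (((y x - z x)\<^sup>2 + d\<^sup>2) * exp (- (C * x)))) has_real_derivative
        (C * ((y x - z x)\<^sup>2 + d\<^sup>2) - 2 * (y x - z x) * (y' x - z' x)) * exp (- (C * x))) (at x)"
      by (auto intro!: derivative_eq_intros y z simp: algebra_simps)
    have "2 * (y x - z x) * (y' x - z' x) \<le> 2 * \<bar>y x - z x\<bar> * \<bar>y' x - z' x\<bar>"
      by (metis abs_ge_self abs_mult abs_numeral)
    also have "\<dots> \<le> 2 * \<bar>y x - z x\<bar> * (L * \<bar>y x - z x\<bar> + d)"
      by (intro mult_left_mono b) auto
    also have "\<dots> = 2 * L * (y x - z x)\<^sup>2 + 2 * \<bar>y x - z x\<bar> * d"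
      by (simp add: algebra_simps power2_eq_square)
    also have "2 * \<bar>y x - z x\<bar> * d \<le> (y x - z x)\<^sup>2 + d\<^sup>2"
      using sum_squares_bound[of "\<bar>y x - z x\<bar>" d] by simp
    finally have "2 * (y x - z x) * (y' x - z' x) \<le> C * (y x - z x)\<^sup>2 + d\<^sup>2"
      by (simp add: C_def algebra_simps)
    moreover have "d\<^sup>2 \<le> C * d\<^sup>2" using \<open>L \<ge> 0\<close> by (simp add: C_def mult_right_mono algebra_simps)
    ultimately have "0 \<le> C * ((y x - z x)\<^sup>2 + d\<^sup>2) - 2 * (y x - z x) * (y' x - z' x)"
      unfolding distrib_left by linarith
    then show "(C * ((y x - z x)\<^sup>2 + d\<^sup>2) - 2 * (y x - z x) * (y' x - z' x)) * exp (- (C * x)) \<ge> 0"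
      by simp
  qed
  then show ?thesis by (simp add: C_def)
qed

text \<open>Zeros are crossed upwards only. If \<open>f\<close> were negative somewhere after
  \<open>a\<close>, the last earlier point with \<open>f \<ge> 0\<close> would be a zero, and
  \<open>f\<close> would be positive right after it.\<close>

lemma barrier_stays_positive:
  fixes f f' :: "real \<Rightarrow> real"
  assumes f: "\<And>x. (f has_real_derivative f' x) (at x)" and fa: "f a \<ge> 0"
    and pos: "\<And>x. f x = 0 \<Longrightarrow> f' x > 0" and "x > a"
  shows "f x > 0"
proof (rule ccontr)
  assume neg: "\<not> f x > 0"
  obtain x2 where x2: "x2 > a" "f x2 < 0"
  proof (cases "f x = 0")
    case False
    then show ?thesis using that neg \<open>x > a\<close> by force
  next
    case True
    \<comment> \<open>A zero at \<open>x\<close> itself is excluded too: the positive derivative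
      makes \<open>f\<close> negative just before \<open>x\<close>.\<close>
    obtain d where d: "d > 0" "\<And>h. 0 < h \<Longrightarrow> h < d \<Longrightarrow> f (x - h) < f x"
      using DERIV_pos_inc_left[OF f pos[OF True]] by blast
    define h where "h = min (d / 2) ((x - a) / 2)"
    have h: "0 < h" "h < d" "a < x - h" using d \<open>x > a\<close>
      by (auto simp: h_def min_def field_simps)
    then show ?thesis using that[of "x - h"] d(2)[of h] True by simp
  qed
  have fc: "continuous_on S f" for S
    by (meson DERIV_isCont continuous_at_imp_continuous_on f)
  define S where "S = {t \<in> {a..x2}. f t \<ge> 0}"
  have "S = {a..x2} \<inter> f -` {0..}" unfolding S_def by auto
  moreover have "compact ({a..x2} \<inter> f -` {0..})"
    by (simp add: compact_Int_closed continuous_on_closed_vimage fc closed_vimage[OF _ fc] compact_eq_bounded_closed bounded_Int closed_Int)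
  ultimately have "compact S" by simp
  moreover have "a \<in> S" unfolding S_def using x2 fa by simp
  ultimately obtain t0 where t0: "t0 \<in> S" "\<And>t. t \<in> S \<Longrightarrow> t \<le> t0"
    using compact_attains_sup[of S] by auto
  have t0x: "t0 < x2" "a \<le> t0" "f t0 \<ge> 0" using t0(1) x2 unfolding S_def by (auto simp: less_le)
  have after: "f t < 0" if "t0 < t" "t \<le> x2" for t
    using t0(2)[of t] that t0x unfolding S_def by force
  have "f t0 = 0"
  proof (rule ccontr)
    assume "f t0 \<noteq> 0"
    then have "f t0 > 0" using t0x by simp
    then obtain t where "t0 \<le> t" "t \<le> x2" "f t = 0"
      using IVT2'[of f x2 0 t0] x2 t0x fc by auto
    then show False using after[of t] \<open>f t0 \<noteq> 0\<close> by (cases "t = t0") auto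
  qed
  then obtain d where d: "d > 0" "\<And>h. 0 < h \<Longrightarrow> h < d \<Longrightarrow> f t0 < f (t0 + h)"
    using DERIV_pos_inc_right[OF f pos] by blast
  define h where "h = min (d / 2) (x2 - t0)"
  have "0 < h" "h < d" "t0 + h \<le> x2" using d t0x by (auto simp: h_def min_def)
  then show False using d(2)[of h] after[of "t0 + h"] \<open>f t0 = 0\<close> by simp
qed


lemma ODE_unique:
  fixes F :: "real \<Rightarrow> real \<Rightarrow> real"
  assumes y: "\<And>x. (y has_real_derivative F x (y x)) (at x)"
    and z: "\<And>x. (z has_real_derivative F x (z x)) (at x)"
    and lip: "\<And>x u v. \<bar>F x u - F x v\<bar> \<le> L * \<bar>u - v\<bar>" and L: "L \<ge> 0" and eq: "y b = z b"
  shows "y x = z x"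
proof (cases "b \<le> x")
  case True
  have "((y x - z x)\<^sup>2 + 0\<^sup>2) * exp (- ((2 * L + 1) * x)) \<le> ((y b - z b)\<^sup>2 + 0\<^sup>2) * exp (- ((2 * L + 1) * b))"
    by (rule diff_square_growth[OF y z _ L True]) (use lip in simp)
  then have "(y x - z x)\<^sup>2 * exp (- ((2 * L + 1) * x)) \<le> 0" using eq by simp
  then show ?thesis by (simp add: mult_le_0_iff)
next
  case False
  \<comment> \<open>The growth estimate runs forward only; points before \<open>b\<close> are
    reached by reflection.\<close>
  have d: "((\<lambda>x. f (- x)) has_real_derivative - F (- x) (f (- x))) (at x)"
    if "\<And>x. (f has_real_derivative F x (f x)) (at x)" for f x
    using DERIV_mirror[of f "F (- x) (f (- x))" x] that by simp
  have "((y (- (- x)) - z (- (- x)))\<^sup>2 + 0\<^sup>2) * exp (- ((2 * L + 1) * (- x)))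
     \<le> ((y (- (- b)) - z (- (- b)))\<^sup>2 + 0\<^sup>2) * exp (- ((2 * L + 1) * (- b)))"
    by (rule diff_square_growth[OF d[OF y] d[OF z] _ L])
      (use False lip in \<open>auto simp: abs_minus_commute\<close>)
  then have "(y x - z x)\<^sup>2 * exp (- ((2 * L + 1) * (- x))) \<le> 0" using eq by simp
  then show ?thesis by (simp add: mult_le_0_iff)
qed

section \<open>Shooting with the Pruefer angle\<close>

lemma abs_cos_diff_le: "\<bar>cos x - cos y\<bar> \<le> \<bar>x - y\<bar>" for x y :: real
proof -
  have "\<bar>cos x - cos y\<bar> = 2 * (\<bar>sin ((x + y) / 2)\<bar> * \<bar>sin ((y - x) / 2)\<bar>)"
    by (simp add: cos_diff_cos abs_mult)
  also have "\<dots> \<le> 2 * (1 * \<bar>(y - x) / 2\<bar>)"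
    by (intro mult_left_mono mult_mono abs_sin_x_le_abs_x) auto
  finally show ?thesis by simp
qed

text \<open>A solution \<open>z\<close> is twice the Pruefer angle of Mathieu's equation: \<open>y' / y = tan (z / 2)\<close>.\<close>

definition prufer_rhs :: "real \<Rightarrow> real \<Rightarrow> real \<Rightarrow> real \<Rightarrow> real" where
  "prufer_rhs q a x z = (2 * q * cos (2 * x) - a) * (1 + cos z) - (1 - cos z)"

text \<open>Two parameters are allowed because the estimate serves both uniqueness in the angle and
  continuity of the shooting map in \<open>a\<close>. On the range of \<open>a\<close> used for
  shooting, the constant depends on \<open>q\<close> alone.\<close>

lemma prufer_rhs_lipschitz:
  assumes "\<bar>a\<bar> \<le> 2 * \<bar>q\<bar> + 1" "\<bar>b\<bar> \<le> 2 * \<bar>q\<bar> + 1"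
  shows "\<bar>prufer_rhs q a x u - prufer_rhs q b x v\<bar> \<le> (4 * \<bar>q\<bar> + 2) * \<bar>u - v\<bar> + 2 * \<bar>a - b\<bar>"
proof -
  have q: "\<bar>2 * q * cos (2 * x)\<bar> \<le> 2 * \<bar>q\<bar> * 1"
    unfolding abs_mult by (intro mult_mono) auto
  have "prufer_rhs q a x u - prufer_rhs q b x v
     = (2 * q * cos (2 * x) - a + 1) * (cos u - cos v) + (b - a) * (1 + cos v)"
    by (simp add: prufer_rhs_def algebra_simps)
  also have "\<bar>\<dots>\<bar> \<le> \<bar>2 * q * cos (2 * x) - a + 1\<bar> * \<bar>cos u - cos v\<bar> + \<bar>b - a\<bar> * \<bar>1 + cos v\<bar>"
    by (metis abs_mult abs_triangle_ineq)
  also have "\<dots> \<le> (4 * \<bar>q\<bar> + 2) * \<bar>u - v\<bar> + \<bar>b - a\<bar> * 2"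
  proof (intro add_mono mult_mono abs_cos_diff_le)
    show "\<bar>2 * q * cos (2 * x) - a + 1\<bar> \<le> 4 * \<bar>q\<bar> + 2" using q assms(1) by linarith
    show "\<bar>1 + cos v\<bar> \<le> 2" using cos_le_one[of v] cos_ge_minus_one[of v] by linarith
  qed auto
  finally show ?thesis by (simp add: abs_minus_commute)
qed

lemma prufer_solution:
  assumes "\<bar>a\<bar> \<le> 2 * \<bar>q\<bar> + 1"
  shows "\<exists>z. z 0 = 0 \<and> (\<forall>x. (z has_real_derivative prufer_rhs q a x (z x)) (at x))"
proof (rule global_ODE_solution)
  show "continuous_on UNIV (\<lambda>(x, y). prufer_rhs q a x y)"
    unfolding prufer_rhs_def case_prod_beta by (intro continuous_intros)
  show "\<bar>prufer_rhs q a x u - prufer_rhs q a x v\<bar> \<le> (4 * \<bar>q\<bar> + 2) * \<bar>u - v\<bar>" for x u v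
    using prufer_rhs_lipschitz[OF assms assms, of x u v] by simp
  show "\<bar>prufer_rhs q a x y\<bar> \<le> (4 * \<bar>q\<bar> + 1) * 2 + 2" for x y
  proof -
    have q: "\<bar>2 * q * cos (2 * x)\<bar> \<le> 2 * \<bar>q\<bar> * 1"
      unfolding abs_mult by (intro mult_mono) auto
    have "\<bar>prufer_rhs q a x y\<bar> \<le> \<bar>2 * q * cos (2 * x) - a\<bar> * \<bar>1 + cos y\<bar> + \<bar>1 - cos y\<bar>"
      unfolding prufer_rhs_def by (metis abs_mult abs_triangle_ineq4)
    also have "\<dots> \<le> (4 * \<bar>q\<bar> + 1) * 2 + 2"
    proof (intro add_mono mult_mono)
      show "\<bar>2 * q * cos (2 * x) - a\<bar> \<le> 4 * \<bar>q\<bar> + 1" using q assms by linarith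
      show "\<bar>1 + cos y\<bar> \<le> 2" "\<bar>1 - cos y\<bar> \<le> 2"
        using cos_le_one[of y] cos_ge_minus_one[of y] by linarith+
    qed auto
    finally show ?thesis .
  qed
qed auto

text \<open>The angle vanishes where \<open>y' = 0\<close>, so these are the Neumann conditions that
  an even \<open>pi\<close>-periodic solution satisfies at \<open>0\<close> and
  \<open>pi / 2\<close>. On the line \<open>z = 0\<close> the slope is
  \<open>2 * (2 * q * cos (2 * x) - a)\<close>. For \<open>a = - R\<close> and \<open>a = R\<close>
  it has a fixed sign, as \<open>R > 2 * |q|\<close>; the two trajectories end on opposite sides of
  zero, and the intermediate value theorem applies in \<open>a\<close>.\<close>

lemma prufer_shooting:
  "\<exists>a z. z 0 = 0 \<and> z (pi / 2) = 0 \<and> \<bar>a\<bar> \<le> 2 * \<bar>q\<bar> + 1 \<and>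
     (\<forall>x. (z has_real_derivative prufer_rhs q a x (z x)) (at x))"
proof -
  define R where "R = 2 * \<bar>q\<bar> + 1"
  define L where "L = 4 * \<bar>q\<bar> + 2"
  have "\<forall>a. \<exists>z. \<bar>a\<bar> \<le> R \<longrightarrow> z 0 = 0 \<and> (\<forall>x. (z has_real_derivative prufer_rhs q a x (z x)) (at x))"
    using prufer_solution unfolding R_def by blast
  then obtain z where z0: "\<And>a. \<bar>a\<bar> \<le> R \<Longrightarrow> z a 0 = 0"
    and z: "\<And>a x. \<bar>a\<bar> \<le> R \<Longrightarrow> (z a has_real_derivative prufer_rhs q a x (z a x)) (at x)"
    by metis
  have q: "\<bar>2 * q * cos (2 * x)\<bar> \<le> 2 * \<bar>q\<bar>" for x
  proof -
    have "\<bar>2 * q * cos (2 * x)\<bar> \<le> 2 * \<bar>q\<bar> * 1" unfolding abs_mult by (intro mult_mono) auto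
    then show ?thesis by simp
  qed
  have R: "\<bar>- R\<bar> \<le> R" "\<bar>R\<bar> \<le> R" "-R \<le> R" unfolding R_def by auto
  have lo: "z (- R) (pi / 2) > 0"
  proof (rule barrier_stays_positive[OF z[OF R(1)], where a = 0])
    show "prufer_rhs q (- R) x (z (- R) x) > 0" if "z (- R) x = 0" for x
      using that q[of x] unfolding prufer_rhs_def R_def by simp
  qed (use z0[OF R(1)] in auto)
  have hi: "- z R (pi / 2) > 0"
  proof (rule barrier_stays_positive[OF DERIV_minus[OF z[OF R(2)]], where a = 0])
    show "- prufer_rhs q R x (z R x) > 0" if "- z R x = 0" for x
      using that q[of x] unfolding prufer_rhs_def R_def by simp
  qed (use z0[OF R(2)] in auto)
  define B where "B = exp ((2 * L + 1) * (pi / 2))"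
  \<comment> \<open>Changing \<open>a\<close> perturbs the right-hand side by at most
    \<open>2 * |a - b|\<close>, the \<open>d\<close> of the growth estimate; hence the end value is
    Lipschitz in \<open>a\<close>.\<close>
  have est: "\<bar>z a (pi / 2) - z b (pi / 2)\<bar> \<le> (2 * B) * \<bar>a - b\<bar>" if "\<bar>a\<bar> \<le> R" "\<bar>b\<bar> \<le> R" for a b
  proof -
    define D where "D = z a (pi / 2) - z b (pi / 2)"
    have "(D\<^sup>2 + (2 * \<bar>a - b\<bar>)\<^sup>2) * exp (- ((2 * L + 1) * (pi / 2)))
       \<le> ((z a 0 - z b 0)\<^sup>2 + (2 * \<bar>a - b\<bar>)\<^sup>2) * exp (- ((2 * L + 1) * 0))"
      unfolding D_def
      by (rule diff_square_growth[OF z[OF that(1)] z[OF that(2)]])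
        (use prufer_rhs_lipschitz[of a q b] that in \<open>auto simp: L_def R_def\<close>)
    then have "(D\<^sup>2 + (2 * \<bar>a - b\<bar>)\<^sup>2) / B \<le> (2 * \<bar>a - b\<bar>)\<^sup>2"
      using z0 that by (simp add: B_def exp_minus field_simps)
    moreover have B1: "B \<ge> 1" unfolding B_def L_def by simp
    ultimately have "D\<^sup>2 + (2 * \<bar>a - b\<bar>)\<^sup>2 \<le> (2 * \<bar>a - b\<bar>)\<^sup>2 * B"
      by (simp add: field_simps)
    then have "D\<^sup>2 \<le> (2 * \<bar>a - b\<bar>)\<^sup>2 * B" by (smt (verit) zero_le_power2)
    also have "\<dots> \<le> (2 * \<bar>a - b\<bar>)\<^sup>2 * B\<^sup>2"
      using B1 by (intro mult_left_mono) (auto simp: power2_eq_square)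
    finally have "D\<^sup>2 \<le> ((2 * B) * \<bar>a - b\<bar>)\<^sup>2" by (simp add: power_mult_distrib mult_ac)
    then show ?thesis using B1 unfolding D_def[symmetric] by (simp add: abs_le_square_iff[symmetric] abs_mult)
  qed
  have "(2 * B)-lipschitz_on {- R..R} (\<lambda>a. z a (pi / 2))"
    by (rule lipschitz_onI) (use est in \<open>auto simp: dist_real_def B_def\<close>)
  then have "continuous_on {- R..R} (\<lambda>a. z a (pi / 2))" by (rule lipschitz_on_continuous_on)
  then obtain a where "-R \<le> a" "a \<le> R" "z a (pi / 2) = 0"
    using IVT2'[of "\<lambda>a. z a (pi / 2)" R 0 "-R"] lo hi R by auto
  then have "z a 0 = 0" "z a (pi / 2) = 0" "\<bar>a\<bar> \<le> R" using z0[of a] by auto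
  with z[of a] show ?thesis unfolding R_def by blast
qed

text \<open>Reflections at \<open>0\<close> and at \<open>pi / 2\<close> both preserve the Pruefer
  equation, and shooting makes \<open>z\<close> vanish at both centres. By uniqueness
  \<open>z\<close> is odd about each of them, hence \<open>pi\<close>-periodic.\<close>

lemma riccati_exists:
  "\<exists>a u. (\<forall>x. (u has_real_derivative (2 * q * cos (2 * x) - a - (u x)\<^sup>2)) (at x)) \<and>
     (\<forall>x. u (- x) = - u x) \<and> (\<forall>x. u (x + pi) = u x)"
proof -
  obtain a z where z0: "z 0 = 0" and zp: "z (pi / 2) = 0" and a: "\<bar>a\<bar> \<le> 2 * \<bar>q\<bar> + 1"
    and z: "\<And>x. (z has_real_derivative prufer_rhs q a x (z x)) (at x)"
    using prufer_shooting[of q] by blast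
  have lip: "\<bar>prufer_rhs q a x u - prufer_rhs q a x v\<bar> \<le> (4 * \<bar>q\<bar> + 2) * \<bar>u - v\<bar>" for x u v
    using prufer_rhs_lipschitz[OF a a, of x u v] by simp
  have odd: "- z (- x) = z x" for x
  proof (rule ODE_unique[where F = "prufer_rhs q a" and z = z and x = x and y = "\<lambda>x. - z (- x)" and b = 0, OF _ z lip])
    have "prufer_rhs q a x (- z (- x)) = prufer_rhs q a (- x) (z (- x))" for x
      by (simp add: prufer_rhs_def)
    then show "((\<lambda>x. - z (- x)) has_real_derivative prufer_rhs q a x (- z (- x))) (at x)" for x
      using DERIV_minus[OF DERIV_mirror[THEN iffD1, OF z[of "- x"]]] by simp
  qed (use z0 in auto)
  have refl: "- z (pi - x) = z x" for x
  proof (rule ODE_unique[where F = "prufer_rhs q a" and z = z and x = x and y = "\<lambda>x. - z (pi - x)" and b = "pi / 2", OF _ z lip])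
    have "cos (2 * (pi - x)) = cos (2 * x)" for x
      by (simp add: right_diff_distrib cos_diff)
    then have "prufer_rhs q a x (- z (pi - x)) = prufer_rhs q a (pi - x) (z (pi - x))" for x
      by (simp add: prufer_rhs_def)
    moreover have "((\<lambda>x. - z (pi - x)) has_real_derivative prufer_rhs q a (pi - x) (z (pi - x))) (at x)" for x
      by (auto intro!: derivative_eq_intros DERIV_chain2[OF z])
    ultimately show "((\<lambda>x. - z (pi - x)) has_real_derivative prufer_rhs q a x (- z (pi - x))) (at x)" for x
      by simp
    show "- z (pi - pi / 2) = z (pi / 2)" using zp by simp
  qed auto
  have per: "z (x + pi) = z x" for x
    using refl[of "- x"] odd[of x] by (simp add: add.commute)
  have pern: "z (x + real n * pi) = z x" for x n
    by (induction n) (use per in \<open>auto simp: algebra_simps\<close>, metis add.assoc add.commute per)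
  \<comment> \<open>On the line \<open>z = pi\<close> the slope is \<open>- 2\<close>, so the angle
    never reaches \<open>pi\<close> to the right of \<open>0\<close>. Periodicity extends this to
    all \<open>x\<close>, and oddness gives the lower bound; \<open>tan (z / 2)\<close> is therefore
    finite and the solution of Mathieu's equation has no zero.\<close>
  have lt_pos: "z x < pi" if "x > 0" for x
  proof -
    have "pi - z x > 0"
    proof (rule barrier_stays_positive[OF _ _ _ that, where f = "\<lambda>x. pi - z x"])
      show "((\<lambda>x. pi - z x) has_real_derivative - prufer_rhs q a x (z x)) (at x)" for x
        by (auto intro!: derivative_eq_intros z)
      show "pi - z 0 \<ge> 0" using z0 by simp
      show "- prufer_rhs q a x (z x) > 0" if "pi - z x = 0" for x
      proof -
        have "z x = pi" using that by simp
        then show ?thesis by (simp add: prufer_rhs_def)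
      qed
    qed
    then show ?thesis by simp
  qed
  have lt: "z x < pi" for x
  proof -
    obtain n :: nat where "- x / pi < real n" using reals_Archimedean2 by blast
    then have "x + real n * pi > 0" by (simp add: field_simps)
    then show ?thesis using lt_pos pern by metis
  qed
  have gt: "- pi < z x" for x using lt[of "- x"] odd[of x] by linarith
  \<comment> \<open>\<open>prufer_rhs\<close> is the Riccati right-hand side for \<open>u\<close>
    times \<open>2 * cos^2 (z / 2) = 1 + cos z\<close>, the factor that makes it bounded and
    Lipschitz.\<close>
  define u where "u x = tan (z x / 2)" for x
  have u: "(u has_real_derivative (2 * q * cos (2 * x) - a - (u x)\<^sup>2)) (at x)" for x
  proof -
    have c: "cos (z x / 2) > 0" using lt[of x] gt[of x] by (intro cos_gt_zero_pi) auto
    define W where "W = 2 * q * cos (2 * x) - a"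
    have cz: "cos (z x) = 2 * (cos (z x / 2))\<^sup>2 - 1" using cos_double_cos[of "z x / 2"] by simp
    have rhs: "prufer_rhs q a x (z x) = W * (2 * (cos (z x / 2))\<^sup>2) - 2 * (sin (z x / 2))\<^sup>2"
      unfolding prufer_rhs_def W_def[symmetric] cz sin_squared_eq by (simp add: algebra_simps)
    have "(u has_real_derivative inverse ((cos (z x / 2))\<^sup>2) * (prufer_rhs q a x (z x) / 2)) (at x)"
      unfolding u_def using c by (auto intro!: derivative_eq_intros z)
    moreover have "inverse ((cos (z x / 2))\<^sup>2) * (prufer_rhs q a x (z x) / 2) = W - (u x)\<^sup>2"
      unfolding rhs u_def tan_def using c by (simp add: field_simps power_divide)
    ultimately show ?thesis unfolding W_def by (simp only:)
  qed
  have "u (- x) = - u x" for x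
  proof -
    have "z (- x) = - z x" using odd[of x] by simp
    then show ?thesis unfolding u_def by simp
  qed
  moreover have "u (x + pi) = u x" for x unfolding u_def by (simp add: per)
  ultimately show ?thesis using u by blast
qed

section \<open>Mathieu ground states\<close>

lemma continuous_on_if_deriv:
  fixes f :: "real \<Rightarrow> real"
  assumes "\<And>x. (f has_real_derivative f' x) (at x)"
  shows "continuous_on S f"
  by (meson assms DERIV_isCont continuous_at_imp_continuous_on)

lemma integral_deriv:
  fixes f f' :: "real \<Rightarrow> real"
  assumes "\<And>x. (f has_real_derivative f' x) (at x)" "a \<le> b"
  shows "(f' has_integral (f b - f a)) {a..b}"
  using assms by (intro fundamental_theorem_of_calculus)
    (auto simp: has_real_derivative_iff_has_vector_derivative intro: has_vector_derivative_at_within)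

lemma integral_zero_imp_zero:
  fixes f :: "real \<Rightarrow> real"
  assumes "continuous_on {a..b} f" "\<And>x. x \<in> {a..b} \<Longrightarrow> f x \<ge> 0" "integral {a..b} f = 0" "a < b" "x \<in> {a..b}"
  shows "f x = 0"
proof -
  have "(f has_integral 0) (cbox a b)"
    using assms by (metis integrable_continuous_interval integrable_integral interval_cbox)
  then show ?thesis using assms has_integral_0_cbox_imp_0[of a b f x] by auto
qed

text \<open>Completing the square leaves the derivative of \<open>v * r^2\<close>, which integrates
  to zero. Since \<open>v\<close> is arbitrary, a Riccati solution gives an exact value while an
  approximate one still gives a bound.\<close>

lemma barta_identity:
  fixes r r' v v' :: "real \<Rightarrow> real"
  assumes r: "\<And>x. (r has_real_derivative r' x) (at x)" and v: "\<And>x. (v has_real_derivative v' x) (at x)"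
    and r'c: "continuous_on UNIV r'" and v'c: "continuous_on UNIV v'"
    and bd: "r a = r b" "v a = v b" and "a \<le> b"
  shows "integral {a..b} (\<lambda>x. (r' x)\<^sup>2)
    = integral {a..b} (\<lambda>x. (- v' x - (v x)\<^sup>2) * (r x)\<^sup>2) + integral {a..b} (\<lambda>x. (r' x - v x * r x)\<^sup>2)"
proof -
  have [continuous_intros]: "continuous_on {a..b} r" "continuous_on {a..b} v"
    "continuous_on {a..b} r'" "continuous_on {a..b} v'"
    using continuous_on_if_deriv r v continuous_on_subset[OF r'c] continuous_on_subset[OF v'c] by blast+
  have "((\<lambda>x. v x * (r x)\<^sup>2) has_real_derivative v' x * (r x)\<^sup>2 + 2 * v x * r x * r' x) (at x)" for x
    by (auto intro!: derivative_eq_intros r v)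
  from integral_deriv[OF this \<open>a \<le> b\<close>]
  have z: "((\<lambda>x. v' x * (r x)\<^sup>2 + 2 * v x * r x * r' x) has_integral 0) {a..b}" using bd by simp
  have "integral {a..b} (\<lambda>x. (- v' x - (v x)\<^sup>2) * (r x)\<^sup>2) + integral {a..b} (\<lambda>x. (r' x - v x * r x)\<^sup>2)
    = integral {a..b} (\<lambda>x. (- v' x - (v x)\<^sup>2) * (r x)\<^sup>2) + integral {a..b} (\<lambda>x. (r' x - v x * r x)\<^sup>2)
    + integral {a..b} (\<lambda>x. v' x * (r x)\<^sup>2 + 2 * v x * r x * r' x)"
    using integral_unique[OF z] by simp
  also have "\<dots> = integral {a..b} (\<lambda>x. (- v' x - (v x)\<^sup>2) * (r x)\<^sup>2 + (r' x - v x * r x)\<^sup>2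
      + (v' x * (r x)\<^sup>2 + 2 * v x * r x * r' x))"
    by (subst Henstock_Kurzweil_Integration.integral_add[symmetric]; (intro integrable_continuous_interval continuous_intros)?)+ simp
  also have "\<dots> = integral {a..b} (\<lambda>x. (r' x)\<^sup>2)"
    by (rule arg_cong[where f = "integral _"]) (auto simp: fun_eq_iff power2_eq_square algebra_simps)
  finally show ?thesis by simp
qed

lemma deriv_shift_add:
  fixes f :: "real \<Rightarrow> real"
  assumes "\<And>x. (f has_real_derivative f' x) (at x)"
  shows "((\<lambda>x. f (x + c)) has_real_derivative f' (x + c)) (at x)"
  using DERIV_shift[of f "f' (x + c)" x c] assms[of "x + c"] by simp

lemma deriv_periodic:
  fixes f :: "real \<Rightarrow> real"
  assumes "\<And>x. (f has_real_derivative f' x) (at x)" "\<And>x. f (x + c) = f x"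
  shows "f' (x + c) = f' x"
  using DERIV_unique[OF deriv_shift_add[OF assms(1), of c x]] assms by simp

lemma deriv_odd:
  fixes f :: "real \<Rightarrow> real"
  assumes "\<And>x. (f has_real_derivative f' x) (at x)" "\<And>x. f (- x) = f x"
  shows "f' (- x) = - f' x"
proof -
  have "((\<lambda>x. f (- x)) has_real_derivative - f' (- x)) (at x)"
    using DERIV_mirror[of f "f' (- x)" x] assms(1)[of "- x"] by simp
  then have "(f has_real_derivative - f' (- x)) (at x)" using assms(2) by simp
  then show ?thesis using DERIV_unique assms(1) by fastforce
qed

lemma mathieu_riccati_potential:
  "\<exists>a U u. (\<forall>x. (U has_real_derivative u x) (at x)) \<and>
     (\<forall>x. (u has_real_derivative (2 * q * cos (2 * x) - a - (u x)\<^sup>2)) (at x)) \<and>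
     (\<forall>x. U (- x) = U x) \<and> (\<forall>x. U (x + pi) = U x)"
proof -
  obtain a u where u: "\<And>x. (u has_real_derivative (2 * q * cos (2 * x) - a - (u x)\<^sup>2)) (at x)"
    and odd: "\<And>x. u (- x) = - u x" and per: "\<And>x. u (x + pi) = u x"
    using riccati_exists[of q] by blast
  obtain U where U: "\<And>x. (U has_real_derivative u x) (at x)"
    using antiderivative_exists[OF continuous_on_if_deriv[OF u]] by blast
  have even: "U (- x) = U x" for x
  proof -
    have "((\<lambda>x. U (- x)) has_real_derivative u x) (at x)" for x
      using DERIV_mirror[of U "u (- x)" x] U[of "- x"] odd by simp
    then show ?thesis using same_deriv_diff_constant[OF _ U, of "\<lambda>x. U (- x)" x 0] by simp
  qed
  have "U (x + pi) = U x" for x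
  proof -
    have "((\<lambda>x. U (x + pi)) has_real_derivative u x) (at x)" for x
      using deriv_shift_add[OF U, of pi x] per by simp
    \<comment> \<open>The difference is constant; at \<open>- pi / 2\<close> evenness makes it
      zero.\<close>
    then have "U (x + pi) - U x = U (- pi / 2 + pi) - U (- pi / 2)"
      by (rule same_deriv_diff_constant) (rule U)
    also have "\<dots> = U (pi / 2) - U (- (pi / 2))" by simp
    finally show ?thesis using even by simp
  qed
  with U u even show ?thesis by blast
qed

lemma exp_mathieu_even_sol:
  assumes U: "\<And>x. (U has_real_derivative u x) (at x)"
    and u: "\<And>x. (u has_real_derivative (2 * q * cos (2 * x) - a - (u x)\<^sup>2)) (at x)"
    and "\<And>x. U (- x) = U x" "\<And>x. U (x + pi) = U x"
  shows "mathieu_even_sol a q (\<lambda>x. exp (U x))"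
proof -
  have "((\<lambda>x. exp (U x)) has_real_derivative exp (U x) * u x) (at x)" for x
    by (auto intro!: derivative_eq_intros U)
  moreover have "((\<lambda>x. exp (U x) * u x) has_real_derivative exp (U x) * (2 * q * cos (2 * x) - a)) (at x)" for x
    by (auto intro!: derivative_eq_intros U u simp: power2_eq_square algebra_simps)
  ultimately show ?thesis unfolding mathieu_even_sol_def using assms(3,4)
    by (intro conjI exI[of _ "\<lambda>x. exp (U x) * u x"] exI[of _ "\<lambda>x. exp (U x) * (2 * q * cos (2 * x) - a)"])
      (auto simp: algebra_simps)
qed

lemma mathieu_even_solE:
  assumes "mathieu_even_sol a q y"
  obtains y' where "\<And>x. (y has_real_derivative y' x) (at x)"
    "\<And>x. (y' has_real_derivative (2 * q * cos (2 * x) - a) * y x) (at x)"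
    "\<And>x. y (- x) = y x" "\<And>x. y (x + pi) = y x" "\<exists>x. y x \<noteq> 0"
proof -
  from assms obtain y1 y2 where y: "\<And>x. (y has_real_derivative y1 x) (at x)"
    "\<And>x. (y1 has_real_derivative y2 x) (at x)" "\<And>x. y2 x + (a - 2 * q * cos (2 * x)) * y x = 0"
    "\<And>x. y (- x) = y x" "\<And>x. y (x + pi) = y x" "\<exists>x. y x \<noteq> 0"
    unfolding mathieu_even_sol_def by blast
  have "y2 x = (2 * q * cos (2 * x) - a) * y x" for x using y(3)[of x] by (simp add: algebra_simps)
  with y show ?thesis using that[of y1] by metis
qed

text \<open>Testing the equation for \<open>b\<close> with \<open>y\<close> gives
  \<open>\<integral> y'^2 = \<integral> (b - 2 q cos 2x) y^2\<close>. Barta's identity with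
  \<open>u\<close> bounds the left side below by the same expression with \<open>a\<close> in place
  of \<open>b\<close>.\<close>

lemma positive_solution_least:
  assumes U: "\<And>x. (U has_real_derivative u x) (at x)"
    and u: "\<And>x. (u has_real_derivative (2 * q * cos (2 * x) - a - (u x)\<^sup>2)) (at x)"
    and per: "\<And>x. U (x + pi) = U x"
    and sol: "mathieu_even_sol b q y"
  shows "a \<le> b"
proof -
  from sol obtain y' where y: "\<And>x. (y has_real_derivative y' x) (at x)"
    and y': "\<And>x. (y' has_real_derivative (2 * q * cos (2 * x) - b) * y x) (at x)"
    and "\<And>x. y (- x) = y x" and yper: "\<And>x. y (x + pi) = y x" and nz: "\<exists>x. y x \<noteq> 0"
    by (rule mathieu_even_solE) blast
  \<comment> \<open>The period is started at a point where \<open>y\<close> is nonzero, which makes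
    the integral of \<open>y^2\<close> positive.\<close>
  obtain c where c: "y c \<noteq> 0" using nz by blast
  define I where "I = {c..c + pi}"
  have cont [continuous_intros]: "continuous_on S y" "continuous_on S y'" "continuous_on S u" for S
    by (fact continuous_on_if_deriv[OF y] continuous_on_if_deriv[OF y'] continuous_on_if_deriv[OF u])+
  have "((\<lambda>x. y x * y' x) has_real_derivative ((y' x)\<^sup>2 + (2 * q * cos (2 * x) - b) * (y x)\<^sup>2)) (at x)" for x
    by (auto intro!: derivative_eq_intros y y' simp: power2_eq_square algebra_simps)
  from integral_deriv[OF this, of c "c + pi"]
  have "integral I (\<lambda>x. (y' x)\<^sup>2 + (2 * q * cos (2 * x) - b) * (y x)\<^sup>2) = 0"
    using yper deriv_periodic[OF y yper] by (auto simp: I_def integral_unique)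
  moreover have "integral I (\<lambda>x. (y' x)\<^sup>2 + (2 * q * cos (2 * x) - b) * (y x)\<^sup>2)
     = integral I (\<lambda>x. (y' x)\<^sup>2) + integral I (\<lambda>x. (2 * q * cos (2 * x) - b) * (y x)\<^sup>2)"
    unfolding I_def by (intro Henstock_Kurzweil_Integration.integral_add integrable_continuous_interval continuous_intros)
  moreover have "integral I (\<lambda>x. (y' x)\<^sup>2)
    = integral I (\<lambda>x. (- (2 * q * cos (2 * x) - a - (u x)\<^sup>2) - (u x)\<^sup>2) * (y x)\<^sup>2) + integral I (\<lambda>x. (y' x - u x * y x)\<^sup>2)"
    unfolding I_def
    by (rule barta_identity[OF y u])
      (use yper deriv_periodic[OF U per] in \<open>auto intro!: continuous_intros\<close>)
  moreover have "integral I (\<lambda>x. (y' x - u x * y x)\<^sup>2) \<ge> 0"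
    by (rule Henstock_Kurzweil_Integration.integral_nonneg)
      (auto simp: I_def intro!: integrable_continuous_interval continuous_intros)
  moreover have "integral I (\<lambda>x. (- (2 * q * cos (2 * x) - a - (u x)\<^sup>2) - (u x)\<^sup>2) * (y x)\<^sup>2)
      + integral I (\<lambda>x. (2 * q * cos (2 * x) - b) * (y x)\<^sup>2) = integral I (\<lambda>x. (a - b) * (y x)\<^sup>2)"
    unfolding I_def
    by (subst Henstock_Kurzweil_Integration.integral_add[symmetric])
      (auto intro!: integrable_continuous_interval continuous_intros simp: algebra_simps)
  ultimately have le: "(a - b) * integral I (\<lambda>x. (y x)\<^sup>2) \<le> 0" by simp
  have "integral I (\<lambda>x. (y x)\<^sup>2) \<noteq> 0"
    using integral_zero_imp_zero[of c "c + pi" "\<lambda>x. (y x)\<^sup>2" c] c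
    by (auto simp: I_def intro!: continuous_intros)
  moreover have "integral I (\<lambda>x. (y x)\<^sup>2) \<ge> 0"
    by (rule Henstock_Kurzweil_Integration.integral_nonneg)
      (auto simp: I_def intro!: integrable_continuous_interval continuous_intros)
  ultimately show ?thesis using le by (simp add: mult_le_0_iff)
qed

text \<open>The parameter found by shooting is itself a characteristic value, with solution
  \<open>exp U\<close>, and positivity makes it the least one. So the infimum defining
  \<open>mathieu_a0\<close> is a genuine minimum.\<close>

lemma mathieu_a0_potential:
  obtains U u where "\<And>x. (U has_real_derivative u x) (at x)"
    "\<And>x. (u has_real_derivative (2 * q * cos (2 * x) - mathieu_a0 q - (u x)\<^sup>2)) (at x)"
    "\<And>x. U (- x) = U x" "\<And>x. U (x + pi) = U x"
proof -
  obtain a U u where U: "\<And>x. (U has_real_derivative u x) (at x)"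
    and u: "\<And>x. (u has_real_derivative (2 * q * cos (2 * x) - a - (u x)\<^sup>2)) (at x)"
    and sym: "\<And>x. U (- x) = U x" "\<And>x. U (x + pi) = U x"
    using mathieu_riccati_potential[of q] by blast
  have "mathieu_a0 q = a"
    unfolding mathieu_a0_def
    by (rule cInf_eq_minimum)
      (use exp_mathieu_even_sol[OF U u sym] positive_solution_least[OF U u sym(2)] in blast)+
  with U u sym show ?thesis using that by blast
qed

lemma mathieu_even_sol_quarter_shift:
  assumes "mathieu_even_sol a q y"
  shows "mathieu_even_sol a (- q) (\<lambda>x. y (x + pi / 2))"
proof -
  from assms obtain y' where y: "\<And>x. (y has_real_derivative y' x) (at x)"
    and y': "\<And>x. (y' has_real_derivative (2 * q * cos (2 * x) - a) * y x) (at x)"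
    and ev: "\<And>x. y (- x) = y x" and per: "\<And>x. y (x + pi) = y x" and nz: "\<exists>x. y x \<noteq> 0"
    by (rule mathieu_even_solE) blast
  have c: "cos (2 * (x + pi / 2)) = - cos (2 * x)" for x by (simp add: distrib_left cos_add)
  have "y (- x + pi / 2) = y (x + pi / 2)" for x
    using ev[of "- x + pi / 2"] per[of "x - pi / 2"] by (simp add: algebra_simps)
  moreover have "y (x + pi + pi / 2) = y (x + pi / 2)" for x
    using per[of "x + pi / 2"] by (simp add: algebra_simps)
  moreover have "\<exists>x. y (x + pi / 2) \<noteq> 0" using nz by (metis diff_add_cancel)
  ultimately show ?thesis unfolding mathieu_even_sol_def
    using deriv_shift_add[OF y, of "pi / 2"] deriv_shift_add[OF y', of "pi / 2"]
    by (intro conjI exI[of _ "\<lambda>x. y' (x + pi / 2)"]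
          exI[of _ "\<lambda>x. (2 * q * cos (2 * (x + pi / 2)) - a) * y (x + pi / 2)"])
      (auto simp: algebra_simps c)
qed

text \<open>Reconciles the \<open>2 / s\<close> in the formula for the minimum with the
  \<open>- 2 / s\<close> in the minimiser: a translation by \<open>pi / 2\<close> flips the sign of
  \<open>cos (2 * x)\<close>.\<close>

lemma mathieu_a0_minus: "mathieu_a0 (- q) = mathieu_a0 q"
proof -
  have "{a. \<exists>y. mathieu_even_sol a (- q) y} = {a. \<exists>y. mathieu_even_sol a q y}"
    using mathieu_even_sol_quarter_shift[of _ q] mathieu_even_sol_quarter_shift[of _ "- q"] by fastforce
  then show ?thesis by (simp add: mathieu_a0_def)
qed

text \<open>\<open>(y' - u * y) * exp U\<close> is the Wronskian of \<open>exp U\<close> and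
  \<open>y\<close>, hence constant, and it vanishes at \<open>0\<close> because both functions are
  even. So \<open>y' = u * y\<close>.\<close>

lemma mathieu_ground_unique:
  assumes U: "\<And>x. (U has_real_derivative u x) (at x)"
    and u: "\<And>x. (u has_real_derivative (2 * q * cos (2 * x) - a - (u x)\<^sup>2)) (at x)"
    and ev: "\<And>x. U (- x) = U x"
    and sol: "mathieu_even_sol a q y"
  shows "\<exists>c. \<forall>x. y x = c * exp (U x)"
proof -
  from sol obtain y' where y: "\<And>x. (y has_real_derivative y' x) (at x)"
    and y': "\<And>x. (y' has_real_derivative (2 * q * cos (2 * x) - a) * y x) (at x)"
    and yev: "\<And>x. y (- x) = y x" and "\<And>x. y (x + pi) = y x" "\<exists>x. y x \<noteq> 0"
    by (rule mathieu_even_solE) blast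
  have "((\<lambda>x. (y' x - u x * y x) * exp (U x)) has_real_derivative 0) (at x)" for x
    by (auto intro!: derivative_eq_intros y y' U u simp: power2_eq_square algebra_simps)
  then have "(y' x - u x * y x) * exp (U x) = (y' 0 - u 0 * y 0) * exp (U 0)" for x
    by (rule constant_if_deriv_zero)
  moreover have "y' 0 = 0" "u 0 = 0" using deriv_odd[OF y yev, of 0] deriv_odd[OF U ev, of 0] by auto
  ultimately have w: "y' x = u x * y x" for x by simp
  have "((\<lambda>x. y x * exp (- U x)) has_real_derivative 0) (at x)" for x
    by (auto intro!: derivative_eq_intros y U simp: w algebra_simps)
  then have "y x * exp (- U x) = y 0 * exp (- U 0)" for x by (rule constant_if_deriv_zero)
  then have "y x = y 0 * exp (- U 0) * exp (U x)" for x by (metis exp_minus_inverse mult.assoc mult.commute mult.right_neutral)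
  then show ?thesis by blast
qed


section \<open>Ground states on the circle and the Ritz principle\<close>

definition energy :: "real \<Rightarrow> real" where
  "energy s = s * mathieu_a0 (2 / s) / 4"

text \<open>\<open>exp U\<close> is the positive ground state of
  \<open>- s d^2/d\<theta>^2 - cos\<close>, normalised as in \<open>unit_state\<close>, and
  \<open>v\<close> is its logarithmic derivative. Working with the logarithm builds positivity
  in.\<close>

definition ground_state :: "real \<Rightarrow> (real \<Rightarrow> real) \<Rightarrow> (real \<Rightarrow> real) \<Rightarrow> bool" where
  "ground_state s U v \<longleftrightarrow> s > 0 \<and>
     (\<forall>x. (U has_real_derivative v x) (at x)) \<and>
     (\<forall>x. (v has_real_derivative (- (energy s + cos x) / s - (v x)\<^sup>2)) (at x)) \<and>
     (\<forall>x. U (- x) = U x) \<and> (\<forall>x. U (x + 2 * pi) = U x) \<and>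
     integral {-pi..pi} (\<lambda>x. exp (2 * U x)) = 2 * pi"

text \<open>The derivative of \<open>exp U\<close> is \<open>v * exp U\<close>, so this is the mean
  of \<open>P^2\<close> and, \<open>exp U\<close> being real, also the variance of
  \<open>P\<close>.\<close>

definition kinetic :: "(real \<Rightarrow> real) \<Rightarrow> (real \<Rightarrow> real) \<Rightarrow> real" where
  "kinetic U v = integral {-pi..pi} (\<lambda>x. (v x)\<^sup>2 * exp (2 * U x)) / (2 * pi)"

definition mean_cos :: "(real \<Rightarrow> real) \<Rightarrow> real" where
  "mean_cos U = integral {-pi..pi} (\<lambda>x. cos x * exp (2 * U x)) / (2 * pi)"

lemma ground_stateD:
  assumes "ground_state s U v"
  shows "s > 0" "\<And>x. (U has_real_derivative v x) (at x)"
    "\<And>x. (v has_real_derivative (- (energy s + cos x) / s - (v x)\<^sup>2)) (at x)"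
    "\<And>x. U (- x) = U x" "\<And>x. U (x + 2 * pi) = U x" "\<And>x. v (- x) = - v x" "\<And>x. v (x + 2 * pi) = v x"
    "integral {-pi..pi} (\<lambda>x. exp (2 * U x)) = 2 * pi"
    "\<And>S. continuous_on S U" "\<And>S. continuous_on S v" "v pi = v (- pi)" "U pi = U (- pi)"
proof -
  show U: "\<And>x. (U has_real_derivative v x) (at x)"
    and v: "\<And>x. (v has_real_derivative (- (energy s + cos x) / s - (v x)\<^sup>2)) (at x)"
    and ev: "\<And>x. U (- x) = U x" and per: "\<And>x. U (x + 2 * pi) = U x" and "s > 0"
    and "integral {-pi..pi} (\<lambda>x. exp (2 * U x)) = 2 * pi"
    using assms unfolding ground_state_def by auto
  show "\<And>S. continuous_on S U" "\<And>S. continuous_on S v"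
    by (fact continuous_on_if_deriv[OF U] continuous_on_if_deriv[OF v])+
  show "\<And>x. v (- x) = - v x" using deriv_odd[OF U ev] .
  show vper: "\<And>x. v (x + 2 * pi) = v x" using deriv_periodic[OF U per] .
  show "v pi = v (- pi)" "U pi = U (- pi)" using vper[of "-pi"] per[of "-pi"] by auto
qed

lemma normalized_potential:
  assumes "continuous_on UNIV U"
  shows "\<exists>c. integral {-pi..pi} (\<lambda>x. exp (2 * (U x + c))) = 2 * pi"
proof -
  have Uc [continuous_intros]: "continuous_on S U" for S using assms continuous_on_subset by blast
  define N where "N = integral {-pi..pi} (\<lambda>x. exp (2 * U x))"
  have ec: "continuous_on {-pi..pi} (\<lambda>x. exp (2 * U x))" by (intro continuous_intros)
  have "N \<noteq> 0"
    unfolding N_def using integral_zero_imp_zero[OF ec, of 0] by auto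
  moreover have "N \<ge> 0" unfolding N_def
    by (rule Henstock_Kurzweil_Integration.integral_nonneg)
      (auto intro!: integrable_continuous_interval continuous_intros)
  ultimately have N: "N > 0" by simp
  define c where "c = ln (2 * pi / N) / 2"
  have "exp (2 * (U x + c)) = (2 * pi / N) * exp (2 * U x)" for x
    using N by (simp add: c_def distrib_left exp_add)
  then have "integral {-pi..pi} (\<lambda>x. exp (2 * (U x + c))) = (2 * pi / N) * N"
    by (simp only: integral_mult_right N_def)
  with N have "integral {-pi..pi} (\<lambda>x. exp (2 * (U x + c))) = 2 * pi" by simp
  then show ?thesis by blast
qed

text \<open>Under \<open>x = \<theta> / 2\<close>, Mathieu's equation multiplied by
  \<open>s / 4\<close> has kinetic coefficient \<open>s\<close>, potential
  \<open>(s q / 2) cos \<theta>\<close> and eigenvalue \<open>s a / 4\<close>; the choice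
  \<open>q = - 2 / s\<close> makes the potential \<open>- cos \<theta>\<close>.\<close>

lemma ground_state_mathieu:
  assumes "s > 0"
  obtains U v where "ground_state s U v"
    "mathieu_even_sol (mathieu_a0 (- 2 / s)) (- 2 / s) (\<lambda>x. exp (U (2 * x)))"
    "\<And>y. mathieu_even_sol (mathieu_a0 (- 2 / s)) (- 2 / s) y \<Longrightarrow> \<exists>c. \<forall>x. y x = c * exp (U (2 * x))"
proof -
  define q where "q = - 2 / s"
  obtain U0 u0 where U0: "\<And>x. (U0 has_real_derivative u0 x) (at x)"
    and u0: "\<And>x. (u0 has_real_derivative (2 * q * cos (2 * x) - mathieu_a0 q - (u0 x)\<^sup>2)) (at x)"
    and ev0: "\<And>x. U0 (- x) = U0 x" and per0: "\<And>x. U0 (x + pi) = U0 x"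
    by (rule mathieu_a0_potential) blast
  have "continuous_on UNIV (\<lambda>x. U0 (x / 2))"
    by (intro continuous_on_compose2[OF continuous_on_if_deriv[OF U0, of UNIV]] continuous_intros) auto
  then obtain c where c: "integral {-pi..pi} (\<lambda>x. exp (2 * (U0 (x / 2) + c))) = 2 * pi"
    using normalized_potential by blast
  define U where "U x = U0 (x / 2) + c" for x
  define v where "v x = u0 (x / 2) / 2" for x
  have "mathieu_a0 q = mathieu_a0 (2 / s)" unfolding q_def using mathieu_a0_minus[of "2 / s"] by simp
  then have a0: "mathieu_a0 q = 4 * energy s / s" using assms unfolding energy_def by simp
  have q_eq: "q * y = - (2 * y / s)" for y unfolding q_def by simp
  have "(U has_real_derivative v x) (at x)" for x
    unfolding U_def v_def by (auto intro!: derivative_eq_intros DERIV_chain2[OF U0])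
  moreover have "(v has_real_derivative (- (energy s + cos x) / s - (v x)\<^sup>2)) (at x)" for x
    unfolding v_def
    by (auto intro!: derivative_eq_intros DERIV_chain2[OF u0] simp: a0 q_eq power2_eq_square diff_divide_distrib add_divide_distrib)
  moreover have "U (- x) = U x" "U (x + 2 * pi) = U x" for x
    using ev0[of "x / 2"] per0[of "x / 2"] by (simp_all add: U_def add_divide_distrib)
  ultimately have gs: "ground_state s U v"
    unfolding ground_state_def using assms c by (simp add: U_def)
  have U2: "((\<lambda>x. U (2 * x)) has_real_derivative u0 x) (at x)" for x
    unfolding U_def by (auto intro!: derivative_eq_intros U0)
  have sym: "U (2 * (- x)) = U (2 * x)" "U (2 * (x + pi)) = U (2 * x)" for x
    using ev0[of x] per0[of x] by (simp_all add: U_def add_divide_distrib)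
  show ?thesis
  proof
    show "ground_state s U v" by fact
    show "mathieu_even_sol (mathieu_a0 (- 2 / s)) (- 2 / s) (\<lambda>x. exp (U (2 * x)))"
      using exp_mathieu_even_sol[OF U2 u0] sym unfolding q_def by blast
    show "\<exists>c. \<forall>x. y x = c * exp (U (2 * x))" if "mathieu_even_sol (mathieu_a0 (- 2 / s)) (- 2 / s) y" for y
      using mathieu_ground_unique[OF U2 u0] sym(1) that unfolding q_def by blast
  qed
qed

lemma riccati_cancel: "- (- a / s - b) - b = a / s" for a b s :: real
  by simp

text \<open>With \<open>r = exp U\<close> the remainder in \<open>barta_identity\<close> vanishes
  identically, so the ground state attains the Ritz value.\<close>

lemma ground_energy:
  assumes "ground_state s U v"
  shows "s * kinetic U v - mean_cos U = energy s"
proof -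
  note g = ground_stateD[OF assms]
  note [continuous_intros] = g(9,10)
  have e: "exp (2 * U x) = (exp (U x))\<^sup>2" for x by (simp add: exp_double)
  define I where "I = {-pi..pi}"
  have "integral I (\<lambda>x. (v x * exp (U x))\<^sup>2)
    = integral I (\<lambda>x. (- (- (energy s + cos x) / s - (v x)\<^sup>2) - (v x)\<^sup>2) * (exp (U x))\<^sup>2)
    + integral I (\<lambda>x. (v x * exp (U x) - v x * exp (U x))\<^sup>2)"
    unfolding I_def by (rule barta_identity[OF _ g(3)])
      (use g in \<open>auto intro!: derivative_eq_intros continuous_intros\<close>)
  then have "s * integral I (\<lambda>x. (v x)\<^sup>2 * exp (2 * U x)) = s * integral I (\<lambda>x. (energy s + cos x) / s * exp (2 * U x))"
    by (simp only: riccati_cancel e power_mult_distrib) simp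
  also have "\<dots> = integral I (\<lambda>x. s * ((energy s + cos x) / s * exp (2 * U x)))" by simp
  also have "\<dots> = integral I (\<lambda>x. energy s * exp (2 * U x) + cos x * exp (2 * U x))"
    using g(1) by (simp add: distrib_right)
  also have "\<dots> = energy s * integral I (\<lambda>x. exp (2 * U x)) + integral I (\<lambda>x. cos x * exp (2 * U x))"
    unfolding I_def
    by (subst Henstock_Kurzweil_Integration.integral_add) (auto intro!: integrable_continuous_interval continuous_intros)
  finally show ?thesis using g(8)
    unfolding kinetic_def mean_cos_def I_def by (simp add: field_simps)
qed

text \<open>The remainder is kept because it measures the gap between \<open>energy\<close> and its
  tangent.\<close>

lemma trial_identity:
  assumes g: "ground_state s U v"
    and r: "\<And>x. (r has_real_derivative r' x) (at x)" and r'c: "continuous_on UNIV r'" and bd: "r (- pi) = r pi"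
  shows "energy s * integral {-pi..pi} (\<lambda>x. (r x)\<^sup>2) + s * integral {-pi..pi} (\<lambda>x. (r' x - v x * r x)\<^sup>2)
    = s * integral {-pi..pi} (\<lambda>x. (r' x)\<^sup>2) - integral {-pi..pi} (\<lambda>x. cos x * (r x)\<^sup>2)"
proof -
  note g = ground_stateD[OF g]
  have [continuous_intros]: "continuous_on S r" for S using continuous_on_if_deriv[OF r] .
  define I where "I = {-pi..pi}"
  have "integral I (\<lambda>x. (r' x)\<^sup>2)
    = integral I (\<lambda>x. (- (- (energy s + cos x) / s - (v x)\<^sup>2) - (v x)\<^sup>2) * (r x)\<^sup>2)
    + integral I (\<lambda>x. (r' x - v x * r x)\<^sup>2)"
    unfolding I_def by (rule barta_identity[OF r g(3) r'c])
      (use g bd in \<open>auto intro!: continuous_intros\<close>)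
  then have "s * integral I (\<lambda>x. (r' x)\<^sup>2) = s * integral I (\<lambda>x. (energy s + cos x) / s * (r x)\<^sup>2)
      + s * integral I (\<lambda>x. (r' x - v x * r x)\<^sup>2)"
    by (simp only: riccati_cancel distrib_left)
  also have "s * integral I (\<lambda>x. (energy s + cos x) / s * (r x)\<^sup>2)
     = integral I (\<lambda>x. s * ((energy s + cos x) / s * (r x)\<^sup>2))" by simp
  also have "\<dots> = integral I (\<lambda>x. energy s * (r x)\<^sup>2 + cos x * (r x)\<^sup>2)"
    using g(1) by (simp add: distrib_right)
  also have "\<dots> = energy s * integral I (\<lambda>x. (r x)\<^sup>2) + integral I (\<lambda>x. cos x * (r x)\<^sup>2)"
    unfolding I_def
    by (subst Henstock_Kurzweil_Integration.integral_add) (auto intro!: integrable_continuous_interval continuous_intros)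
  finally show ?thesis unfolding I_def by simp
qed

lemma trial_upper_bound:
  assumes s: "s > 0"
    and r: "\<And>x. (r has_real_derivative r' x) (at x)" and r'c: "continuous_on UNIV r'" and bd: "r (- pi) = r pi"
  shows "energy s * integral {-pi..pi} (\<lambda>x. (r x)\<^sup>2)
    \<le> s * integral {-pi..pi} (\<lambda>x. (r' x)\<^sup>2) - integral {-pi..pi} (\<lambda>x. cos x * (r x)\<^sup>2)"
proof -
  obtain U v where g: "ground_state s U v" using ground_state_mathieu[OF s] by metis
  have [continuous_intros]: "continuous_on S r" "continuous_on S v" "continuous_on S r'" for S
    using continuous_on_if_deriv[OF r] ground_stateD[OF g] continuous_on_subset[OF r'c] by auto
  have "integral {-pi..pi} (\<lambda>x. (r' x - v x * r x)\<^sup>2) \<ge> 0"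
    by (rule Henstock_Kurzweil_Integration.integral_nonneg)
      (auto intro!: integrable_continuous_interval continuous_intros)
  then have "s * integral {-pi..pi} (\<lambda>x. (r' x - v x * r x)\<^sup>2) \<ge> 0" using s by simp
  then show ?thesis using trial_identity[OF g r r'c bd] by linarith
qed

text \<open>Barta's principle: \<open>s * (- w' - w^2) - cos\<close> is the local energy of the
  positive function with logarithmic derivative \<open>w\<close>. Inserting \<open>w\<close> into
  the identity for the true ground state averages this local energy with weight
  \<open>exp (2 * U)\<close>, and the average is at most \<open>energy s\<close>.\<close>

lemma barta_lower_bound:
  assumes s: "s > 0"
    and w: "\<And>x. (w has_real_derivative w' x) (at x)" and w'c: "continuous_on UNIV w'" and bd: "w (- pi) = w pi"
    and m: "\<And>x. x \<in> {-pi..pi} \<Longrightarrow> m \<le> s * (- w' x - (w x)\<^sup>2) - cos x"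
  shows "m \<le> energy s"
proof -
  obtain U v where g0: "ground_state s U v" using ground_state_mathieu[OF s] by metis
  note g = ground_stateD[OF g0]
  note [continuous_intros] = g(9,10)
  have [continuous_intros]: "continuous_on S w" "continuous_on S w'" for S
    using continuous_on_if_deriv[OF w] continuous_on_subset[OF w'c] by auto
  have e: "exp (2 * U x) = (exp (U x))\<^sup>2" for x by (simp add: exp_double)
  define I where "I = {-pi..pi}"
  have int: "f integrable_on I" if "continuous_on UNIV f" for f :: "real \<Rightarrow> real"
    unfolding I_def using that continuous_on_subset by (intro integrable_continuous_interval) blast
  have "integral I (\<lambda>x. (v x * exp (U x))\<^sup>2)
    = integral I (\<lambda>x. (- w' x - (w x)\<^sup>2) * (exp (U x))\<^sup>2)
    + integral I (\<lambda>x. (v x * exp (U x) - w x * exp (U x))\<^sup>2)"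
    unfolding I_def by (rule barta_identity[OF _ w])
      (use g bd in \<open>auto intro!: derivative_eq_intros continuous_intros\<close>)
  moreover have "integral I (\<lambda>x. (v x * exp (U x) - w x * exp (U x))\<^sup>2) \<ge> 0"
    by (intro Henstock_Kurzweil_Integration.integral_nonneg int continuous_intros) auto
  ultimately have "integral I (\<lambda>x. (- w' x - (w x)\<^sup>2) * exp (2 * U x)) \<le> integral I (\<lambda>x. (v x)\<^sup>2 * exp (2 * U x))"
    by (simp add: e power_mult_distrib)
  then have "s * integral I (\<lambda>x. (- w' x - (w x)\<^sup>2) * exp (2 * U x)) - integral I (\<lambda>x. cos x * exp (2 * U x))
    \<le> s * integral I (\<lambda>x. (v x)\<^sup>2 * exp (2 * U x)) - integral I (\<lambda>x. cos x * exp (2 * U x))"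
    using s by (intro diff_mono mult_left_mono) auto
  also have "\<dots> = 2 * pi * energy s"
    using ground_energy[OF g0] unfolding kinetic_def mean_cos_def I_def by (simp add: field_simps)
  finally have le: "s * integral I (\<lambda>x. (- w' x - (w x)\<^sup>2) * exp (2 * U x)) - integral I (\<lambda>x. cos x * exp (2 * U x))
    \<le> 2 * pi * energy s" .
  have "m * (2 * pi) = integral I (\<lambda>x. m * exp (2 * U x))" using g(8) unfolding I_def by simp
  also have "\<dots> \<le> integral I (\<lambda>x. (s * (- w' x - (w x)\<^sup>2) - cos x) * exp (2 * U x))"
    by (intro integral_le int continuous_intros mult_right_mono m) (auto simp: I_def)
  also have "\<dots> = integral I (\<lambda>x. s * ((- w' x - (w x)\<^sup>2) * exp (2 * U x)) - cos x * exp (2 * U x))"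
    by (simp add: algebra_simps)
  also have "\<dots> = s * integral I (\<lambda>x. (- w' x - (w x)\<^sup>2) * exp (2 * U x)) - integral I (\<lambda>x. cos x * exp (2 * U x))"
    by (subst Henstock_Kurzweil_Integration.integral_diff) (auto intro!: int continuous_intros)
  also note le
  finally show ?thesis by simp
qed

section \<open>The ground state energy as a function of the coupling\<close>

lemma energy_nonpos:
  assumes "s > 0"
  shows "energy s \<le> 0"
proof -
  have "(cos has_integral (sin pi - sin (- pi))) {-pi..pi}"
    by (rule integral_deriv) (auto intro!: derivative_eq_intros)
  then have "integral {-pi..pi} cos = (0::real)" by (simp add: integral_unique)
  then show ?thesis
    using trial_upper_bound[OF assms, of "\<lambda>_. 1" "\<lambda>_. 0"] pi_gt_zero
    by (auto simp: mult_le_0_iff simp del: pi_gt_zero)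
qed

text \<open>\<open>- k * sin\<close> is the logarithmic derivative of \<open>exp (k * cos)\<close>.
  Its local energy exceeds \<open>- 1 + s * k\<close> by \<open>1 - cos x\<close> times a factor
  that is smallest at \<open>cos x = 1\<close>, where the hypothesis on \<open>k\<close> makes it
  nonnegative.\<close>

lemma energy_lower_bound:
  assumes "s > 0" and k: "s * (k + 2 * k\<^sup>2) \<le> 1" "k \<ge> 0"
  shows "- 1 + s * k \<le> energy s"
proof (rule barta_lower_bound[OF \<open>s > 0\<close>, where w = "\<lambda>x. - k * sin x" and w' = "\<lambda>x. - k * cos x"])
  show "((\<lambda>x. - k * sin x) has_real_derivative - k * cos x) (at x)" for x
    by (auto intro!: derivative_eq_intros)
  fix x :: real
  have "(1 - cos x) * (1 - s * k - s * k\<^sup>2 * (1 + cos x)) \<ge> 0"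
  proof (rule mult_nonneg_nonneg)
    have "s * k\<^sup>2 * (1 + cos x) \<le> s * k\<^sup>2 * 2" using \<open>s > 0\<close> by (intro mult_left_mono) auto
    then show "1 - s * k - s * k\<^sup>2 * (1 + cos x) \<ge> 0" using k by (simp add: algebra_simps)
  qed simp
  moreover have "s * (- (- k * cos x) - (- k * sin x)\<^sup>2) - cos x
      = - 1 + s * k + (1 - cos x) * (1 - s * k - s * k\<^sup>2 * (1 + cos x))"
    by (simp add: power_mult_distrib sin_squared_eq) (simp add: algebra_simps power2_eq_square)
  ultimately show "- 1 + s * k \<le> s * (- (- k * cos x) - (- k * sin x)\<^sup>2) - cos x" by simp
qed (auto intro!: continuous_intros)

lemma ground_state_trial:
  assumes "ground_state s U v"
  shows "((\<lambda>x. exp (U x)) has_real_derivative v x * exp (U x)) (at x)"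
    "continuous_on UNIV (\<lambda>x. v x * exp (U x))" "exp (U (- pi)) = exp (U pi)"
    "integral {-pi..pi} (\<lambda>x. (exp (U x))\<^sup>2) = 2 * pi"
    "integral {-pi..pi} (\<lambda>x. (v x * exp (U x))\<^sup>2) = 2 * pi * kinetic U v"
    "integral {-pi..pi} (\<lambda>x. cos x * (exp (U x))\<^sup>2) = 2 * pi * mean_cos U"
proof -
  note g = ground_stateD[OF assms]
  have e: "exp (2 * U x) = (exp (U x))\<^sup>2" for x by (simp add: exp_double)
  show "((\<lambda>x. exp (U x)) has_real_derivative v x * exp (U x)) (at x)"
    by (auto intro!: derivative_eq_intros g(2))
  show "continuous_on UNIV (\<lambda>x. v x * exp (U x))" by (intro continuous_intros g(9,10))
  show "exp (U (- pi)) = exp (U pi)" using g(12) by simp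
  show "integral {-pi..pi} (\<lambda>x. (exp (U x))\<^sup>2) = 2 * pi" using g(8) by (simp add: e)
  show "integral {-pi..pi} (\<lambda>x. (v x * exp (U x))\<^sup>2) = 2 * pi * kinetic U v"
    by (simp add: kinetic_def e power_mult_distrib)
  show "integral {-pi..pi} (\<lambda>x. cos x * (exp (U x))\<^sup>2) = 2 * pi * mean_cos U"
    by (simp add: mean_cos_def e)
qed

text \<open>The ground state at \<open>s\<close> serves as trial function at \<open>t\<close>. Its
  Ritz value is affine in \<open>t\<close> with slope \<open>kinetic U v\<close>, and the remainder
  is the exact gap.\<close>

lemma energy_tangent_gap:
  assumes g: "ground_state s U v" and h: "ground_state t U2 v2"
  shows "2 * pi * (energy s + (t - s) * kinetic U v - energy t)
    = t * integral {-pi..pi} (\<lambda>x. (v x * exp (U x) - v2 x * exp (U x))\<^sup>2)"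
  using trial_identity[OF h ground_state_trial(1)[OF g]] ground_state_trial[OF g] ground_energy[OF g]
  by (simp add: algebra_simps)

lemma energy_below_tangent:
  assumes g: "ground_state s U v" and t: "t > 0"
  shows "energy t \<le> energy s + (t - s) * kinetic U v"
proof -
  have "energy t * (2 * pi) \<le> t * (2 * pi * kinetic U v) - 2 * pi * mean_cos U"
    using trial_upper_bound[OF t ground_state_trial(1)[OF g]] ground_state_trial[OF g] by simp
  also have "\<dots> = (energy s + (t - s) * kinetic U v) * (2 * pi)"
    using ground_energy[OF g] by (simp add: algebra_simps)
  finally show ?thesis by simp
qed

lemma energy_strictly_below_tangent:
  assumes g: "ground_state s U v" and t: "t > 0" and ne: "t \<noteq> s"
  shows "energy t < energy s + (t - s) * kinetic U v"
proof (rule ccontr)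
  assume "\<not> ?thesis"
  with energy_below_tangent[OF g t] have eq: "energy t = energy s + (t - s) * kinetic U v" by simp
  obtain U2 v2 where h: "ground_state t U2 v2" using ground_state_mathieu[OF t] by metis
  note g' = ground_stateD[OF g] and h' = ground_stateD[OF h]
  have z: "integral {-pi..pi} (\<lambda>x. (v x * exp (U x) - v2 x * exp (U x))\<^sup>2) = 0"
    using energy_tangent_gap[OF g h] eq t by simp
  have vv: "v x = v2 x" if "x \<in> {-pi..pi}" for x
  proof -
    have "continuous_on {-pi..pi} (\<lambda>x. (v x * exp (U x) - v2 x * exp (U x))\<^sup>2)"
      by (intro continuous_intros g' h')
    from integral_zero_imp_zero[OF this _ z _ that] show ?thesis by simp
  qed
  have d: "- (energy s + cos x) / s - (v x)\<^sup>2 = - (energy t + cos x) / t - (v2 x)\<^sup>2" if "x \<in> {-pi<..<pi}" for x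
  proof (rule DERIV_unique[OF g'(3)])
    show "(v has_real_derivative - (energy t + cos x) / t - (v2 x)\<^sup>2) (at x)"
      by (rule has_field_derivative_transform_within_open[OF h'(3) _ that]) (use vv in auto)
  qed
  \<comment> \<open>Equality has forced the logarithmic derivatives, hence the two Riccati
    equations, to agree; the values 1 and 0 of \<open>cos\<close> at \<open>0\<close> and
    \<open>pi / 2\<close> separate \<open>1 / s\<close> from \<open>energy s / s\<close>.\<close>
  from d[of 0] d[of "pi / 2"] vv[of 0] vv[of "pi / 2"]
  have "(- energy s - 1) / s = (- energy t - 1) / t" "energy s / s = energy t / t" by auto
  then have "1 / s = 1 / t" by (simp add: diff_divide_distrib)
  then show False using ne g'(1) t by simp
qed

text \<open>Lower bounds come from trial logarithmic derivatives, here \<open>v + e * w\<close> with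
  local energy constant to first order. This forces \<open>w' + 2 * v * w = cos - C\<close>; after
  multiplication by the integrating factor \<open>exp (2 * U)\<close>, a periodic solution exists
  exactly if the right side has mean zero, that is, if \<open>C\<close> is
  \<open>mean_cos U\<close>.\<close>

lemma energy_above_parabola:
  assumes g0: "ground_state s U v"
  shows "\<exists>M\<ge>0. \<forall>t>0. energy s + (t - s) * kinetic U v - (t - s)\<^sup>2 / (s\<^sup>2 * t) * M \<le> energy t"
proof -
  note g = ground_stateD[OF g0]
  define C where "C = mean_cos U"
  have "continuous_on UNIV (\<lambda>x. (cos x - C) * exp (2 * U x))" by (intro continuous_intros g)
  then obtain B where B: "\<And>x. (B has_real_derivative (cos x - C) * exp (2 * U x)) (at x)"
    using antiderivative_exists by blast
  have "integral {-pi..pi} (\<lambda>x. (cos x - C) * exp (2 * U x))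
     = integral {-pi..pi} (\<lambda>x. cos x * exp (2 * U x)) - C * integral {-pi..pi} (\<lambda>x. exp (2 * U x))"
    unfolding left_diff_distrib
    by (subst Henstock_Kurzweil_Integration.integral_diff) (auto intro!: integrable_continuous_interval continuous_intros g)
  also have "\<dots> = 0" using g(8) by (simp add: C_def mean_cos_def)
  finally have "B pi = B (- pi)" using integral_unique[OF integral_deriv[OF B, of "-pi" pi]] by simp
  define w where "w x = B x * exp (- (2 * U x))" for x
  have w: "(w has_real_derivative (cos x - C - 2 * v x * w x)) (at x)" for x
  proof -
    have "(w has_real_derivative (cos x - C) * exp (2 * U x) * exp (- (2 * U x))
        + exp (- (2 * U x)) * (- (2 * v x)) * B x) (at x)"
      unfolding w_def by (rule DERIV_mult[OF B]) (auto intro!: derivative_eq_intros g(2))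
    moreover have "(cos x - C) * exp (2 * U x) * exp (- (2 * U x)) + exp (- (2 * U x)) * (- (2 * v x)) * B x
        = cos x - C - 2 * v x * w x"
      by (simp add: w_def exp_minus)
    ultimately show ?thesis by (simp only:)
  qed
  have wbd: "w pi = w (- pi)" unfolding w_def using \<open>B pi = B (- pi)\<close> g(12) by simp
  have wc: "continuous_on S w" for S by (rule continuous_on_if_deriv[OF w])
  have "continuous_on {-pi..pi} (\<lambda>x. (w x)\<^sup>2)" by (intro continuous_on_power wc)
  then obtain M where M: "\<And>x. x \<in> {-pi..pi} \<Longrightarrow> (w x)\<^sup>2 \<le> M"
    using continuous_attains_sup[of "{-pi..pi}" "\<lambda>x. (w x)\<^sup>2"] by fastforce
  have "M \<ge> 0" using M[of 0] by (smt (verit) atLeastAtMost_iff pi_ge_zero zero_le_power2)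
  have "energy s + (t - s) * kinetic U v - (t - s)\<^sup>2 / (s\<^sup>2 * t) * M \<le> energy t" if t: "t > 0" for t
  proof -
    \<comment> \<open>Here \<open>e = 1 / s - 1 / t\<close>, for which the multiples of
      \<open>cos x\<close> in the local energy cancel; what remains is the tangent value minus
      \<open>t * e^2 * w^2\<close>.\<close>
    define e where "e = (t - s) / (s * t)"
    show ?thesis
    proof (rule barta_lower_bound[OF t, where w = "\<lambda>x. v x + e * w x"
          and w' = "\<lambda>x. - (energy s + cos x) / s - (v x)\<^sup>2 + e * (cos x - C - 2 * v x * w x)"])
      show "((\<lambda>x. v x + e * w x) has_real_derivative
          - (energy s + cos x) / s - (v x)\<^sup>2 + e * (cos x - C - 2 * v x * w x)) (at x)" for x
        by (rule DERIV_add[OF g(3) DERIV_cmult[OF w]])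
      show "continuous_on UNIV (\<lambda>x. - (energy s + cos x) / s - (v x)\<^sup>2 + e * (cos x - C - 2 * v x * w x))"
        using g(1) by (intro continuous_intros g wc) auto
      show "v (- pi) + e * w (- pi) = v pi + e * w pi" using wbd g(11) by simp
      fix x assume x: "x \<in> {-pi..pi}"
      have te: "t * e\<^sup>2 = (t - s)\<^sup>2 / (s\<^sup>2 * t)" "t * e = (t - s) / s"
        unfolding e_def using g(1) t by (simp_all add: field_simps power2_eq_square)
      have "t * (- (- (energy s + cos x) / s - (v x)\<^sup>2 + e * (cos x - C - 2 * v x * w x)) - (v x + e * w x)\<^sup>2) - cos x
        = t * ((energy s + cos x) / s) - (t * e) * (cos x - C) - cos x - (t * e\<^sup>2) * (w x)\<^sup>2"
        unfolding minus_divide_left[symmetric] by algebra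
      also have "t * ((energy s + cos x) / s) - (t * e) * (cos x - C) - cos x = energy s + (t - s) * kinetic U v"
        unfolding te ground_energy[OF g0, symmetric] C_def[symmetric] using g(1) by (simp add: field_simps)
      finally show "energy s + (t - s) * kinetic U v - (t - s)\<^sup>2 / (s\<^sup>2 * t) * M
         \<le> t * (- (- (energy s + cos x) / s - (v x)\<^sup>2 + e * (cos x - C - 2 * v x * w x)) - (v x + e * w x)\<^sup>2) - cos x"
        using mult_left_mono[OF M[OF x], of "(t - s)\<^sup>2 / (s\<^sup>2 * t)"] t unfolding te by simp
    qed
  qed
  with \<open>M \<ge> 0\<close> show ?thesis by blast
qed

text \<open>\<open>energy\<close> is squeezed between its tangent and a curve from below that
  touches it at \<open>s\<close> with the same slope.\<close>

lemma energy_has_derivative: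
  assumes g: "ground_state s U v"
  shows "(energy has_real_derivative kinetic U v) (at s)"
proof -
  have s: "s > 0" using ground_stateD[OF g] by simp
  obtain M where M: "M \<ge> 0"
    "\<And>t. t > 0 \<Longrightarrow> energy s + (t - s) * kinetic U v - (t - s)\<^sup>2 / (s\<^sup>2 * t) * M \<le> energy t"
    using energy_above_parabola[OF g] by blast
  \<comment> \<open>From \<open>h^2 / (s^2 * (s + h)) \<le> 2 * h^2 / s^3\<close>, valid as
    \<open>s + h > s / 2\<close>.\<close>
  define A where "A = 2 * M / s ^ 3"
  have bnd: "norm ((energy (s + h) - energy s) / h - kinetic U v) \<le> A * \<bar>h\<bar>" if h: "h \<noteq> 0" "dist h 0 < s / 2" for h
  proof -
    have t: "s + h > s / 2" "s + h > 0" using h s by (auto simp: dist_real_def)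
    have "h\<^sup>2 / (s\<^sup>2 * (s + h)) * M \<le> h\<^sup>2 / (s\<^sup>2 * (s / 2)) * M"
      using t s M(1) by (intro mult_right_mono divide_left_mono mult_left_mono) auto
    also have "\<dots> = A * h\<^sup>2" unfolding A_def by (simp add: power2_eq_square power3_eq_cube)
    finally have "energy s + h * kinetic U v - A * h\<^sup>2 \<le> energy (s + h)" using M(2)[OF t(2)] by simp
    moreover have "energy (s + h) \<le> energy s + h * kinetic U v" using energy_below_tangent[OF g t(2)] by simp
    ultimately have "\<bar>energy (s + h) - energy s - h * kinetic U v\<bar> \<le> A * h\<^sup>2" by (simp add: abs_if)
    moreover have "(energy (s + h) - energy s) / h - kinetic U v = (energy (s + h) - energy s - h * kinetic U v) / h"
      using h by (simp add: field_simps)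
    moreover have "A * h\<^sup>2 / \<bar>h\<bar> = A * \<bar>h\<bar>" using h by (simp add: power2_eq_square abs_if)
    ultimately show ?thesis using h
      by (metis abs_divide divide_right_mono abs_ge_zero real_norm_def)
  qed
  have "((\<lambda>h. (energy (s + h) - energy s) / h - kinetic U v) \<longlongrightarrow> 0) (at 0)"
  proof (rule Lim_null_comparison)
    show "\<forall>\<^sub>F h in at 0. norm ((energy (s + h) - energy s) / h - kinetic U v) \<le> A * \<bar>h\<bar>"
      unfolding eventually_at using bnd s by (intro exI[of _ "s / 2"]) auto
    show "((\<lambda>h. A * \<bar>h\<bar>) \<longlongrightarrow> 0) (at 0)" by (auto intro!: tendsto_eq_intros)
  qed
  then show ?thesis unfolding DERIV_def by (simp add: LIM_zero_iff)
qed

section \<open>Couplings near zero and the optimal coupling\<close>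

text \<open>The trial functions \<open>(1 + cos x)^m\<close> concentrate at \<open>0\<close>, the
  minimum of \<open>- cos\<close>. A large \<open>m\<close> brings the potential energy close to
  \<open>- 1\<close>; the kinetic integral \<open>K\<close> is then fixed and is suppressed by a
  small \<open>s\<close>.\<close>

lemma energy_small_coupling:
  assumes "\<epsilon> > 0" "b > 0"
  shows "\<exists>s. 0 < s \<and> s < b \<and> energy s < - 1 + \<epsilon>"
proof -
  obtain m :: nat where m: "real m > 2 / \<epsilon> + 1" using reals_Archimedean2 by blast
  then have m1: "m \<ge> 1" "2 * m \<ge> 1" "1 / (2 * real m + 1) < \<epsilon> / 2"
  proof -
    have "real m > 1" using m assms by (smt (verit) divide_pos_pos)
    then show "m \<ge> 1" "2 * m \<ge> 1" by auto
    have "\<epsilon> * real m > 2" using m assms by (simp add: field_simps)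
    then have "\<epsilon> * (2 * real m + 1) > 2" using assms by (simp add: algebra_simps)
    then show "1 / (2 * real m + 1) < \<epsilon> / 2" by (simp add: field_simps)
  qed
  define r where "r x = (1 + cos x) ^ m" for x :: real
  define r' where "r' x = - (real m * (1 + cos x) ^ (m - 1) * sin x)" for x :: real
  have r: "(r has_real_derivative r' x) (at x)" for x
    unfolding r_def r'_def by (auto intro!: derivative_eq_intros)
  have r'c: "continuous_on S r'" for S unfolding r'_def by (intro continuous_intros)
  have rc: "continuous_on S r" for S unfolding r_def by (intro continuous_intros)
  define I where "I = {-pi..pi}"
  define N where "N = integral I (\<lambda>x. (r x)\<^sup>2)"
  define K where "K = integral I (\<lambda>x. (r' x)\<^sup>2)"
  have N: "N > 0"
  proof -
    have "continuous_on {-pi..pi} (\<lambda>x. (r x)\<^sup>2)" by (intro continuous_intros rc)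
    from integral_zero_imp_zero[OF this, of 0] have "N \<noteq> 0" unfolding N_def I_def
      by (auto simp: r_def)
    moreover have "N \<ge> 0" unfolding N_def I_def
      by (intro Henstock_Kurzweil_Integration.integral_nonneg integrable_continuous_interval continuous_intros rc) auto
    ultimately show ?thesis by simp
  qed
  have K: "K \<ge> 0" unfolding K_def I_def
    by (intro Henstock_Kurzweil_Integration.integral_nonneg integrable_continuous_interval continuous_intros r'c) auto
  have C: "integral I (\<lambda>x. cos x * (r x)\<^sup>2) = (1 - 1 / (2 * real m + 1)) * N"
  proof -
    \<comment> \<open>The vanishing integral of this derivative gives
      \<open>(2 m + 1) \<integral> cos r^2 = 2 m \<integral> r^2\<close>, the mean of
      \<open>cos\<close> without computing either integral.\<close>
    have "((\<lambda>x. sin x * (1 + cos x) ^ (2 * m)) has_real_derivative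
        ((2 * real m + 1) * (cos x * (r x)\<^sup>2) - 2 * real m * (r x)\<^sup>2)) (at x)" for x
    proof -
      have "((\<lambda>x. sin x * (1 + cos x) ^ (2 * m)) has_real_derivative
        cos x * (1 + cos x) ^ (2 * m) - 2 * real m * ((sin x)\<^sup>2 * (1 + cos x) ^ (2 * m - 1))) (at x)"
        by (auto intro!: derivative_eq_intros simp: power2_eq_square)
      moreover have "(sin x)\<^sup>2 * (1 + cos x) ^ (2 * m - 1) = (1 - cos x) * (1 + cos x) ^ (2 * m)"
      proof -
        have "(sin x)\<^sup>2 = (1 - cos x) * (1 + cos x)"
          unfolding sin_squared_eq by (simp add: algebra_simps power2_eq_square)
        moreover have "(1 + cos x) ^ (2 * m) = (1 + cos x) * (1 + cos x) ^ (2 * m - 1)"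
          using m1(2) by (metis Suc_diff_1 less_le_trans power_Suc zero_less_one)
        ultimately show ?thesis by simp
      qed
      moreover have "(1 + cos x) ^ (2 * m) = (r x)\<^sup>2" by (simp add: r_def power_even_eq)
      moreover have "cos x * (r x)\<^sup>2 - 2 * real m * ((1 - cos x) * (r x)\<^sup>2)
          = (2 * real m + 1) * (cos x * (r x)\<^sup>2) - 2 * real m * (r x)\<^sup>2"
        by (simp add: algebra_simps)
      ultimately show ?thesis by (simp only:)
    qed
    from integral_unique[OF integral_deriv[OF this, of "-pi" pi]]
    have "integral I (\<lambda>x. (2 * real m + 1) * (cos x * (r x)\<^sup>2) - 2 * real m * (r x)\<^sup>2) = 0"
      by (simp add: I_def)
    moreover have "integral I (\<lambda>x. (2 * real m + 1) * (cos x * (r x)\<^sup>2) - 2 * real m * (r x)\<^sup>2)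
       = (2 * real m + 1) * integral I (\<lambda>x. cos x * (r x)\<^sup>2) - 2 * real m * N"
      unfolding N_def I_def
      by (subst Henstock_Kurzweil_Integration.integral_diff)
        (auto intro!: integrable_continuous_interval continuous_intros rc)
    ultimately show ?thesis by (simp add: field_simps)
  qed
  \<comment> \<open>The second argument makes \<open>s * K\<close> at most half of
    \<open>\<epsilon> * N\<close>; \<open>K + 1\<close> keeps the denominator positive.\<close>
  define s where "s = min (b / 2) (\<epsilon> * N / (2 * (K + 1)))"
  have s: "0 < s" "s < b" using assms N K unfolding s_def by (simp_all add: min_less_iff_disj)
  have "s * K \<le> \<epsilon> * N / (2 * (K + 1)) * K" unfolding s_def using K by (intro mult_right_mono) auto
  also have "\<dots> \<le> \<epsilon> * N / 2"
    using K N assms by (simp add: field_simps)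
  finally have sK: "s * K \<le> \<epsilon> * N / 2" .
  have "energy s * N \<le> s * K - (1 - 1 / (2 * real m + 1)) * N"
    using trial_upper_bound[OF s(1) r r'c] C unfolding N_def K_def I_def by (simp add: r_def)
  also have "\<dots> \<le> (\<epsilon> / 2 - 1 + 1 / (2 * real m + 1)) * N" using sK by (simp add: algebra_simps)
  finally have "energy s \<le> \<epsilon> / 2 - 1 + 1 / (2 * real m + 1)" using N by simp
  then have "energy s < - 1 + \<epsilon>" using m1(3) by linarith
  with s show ?thesis by blast
qed

lemma optimal_coupling_exists:
  assumes E: "E > 0"
  shows "\<exists>s U v. ground_state s U v \<and> kinetic U v = E"
proof -
  define f where "f s = energy s - s * E" for s
  \<comment> \<open>With slope \<open>2 * E\<close> in the lower bound, \<open>s1 * E\<close> is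
    left over after subtracting \<open>s1 * E\<close>; \<open>s1\<close> is the largest coupling the
    bound admits for this slope.\<close>
  define k where "k = 2 * E"
  define s1 where "s1 = 1 / (k + 2 * k\<^sup>2)"
  have k: "k > 0" unfolding k_def using E by simp
  have s1: "s1 > 0" unfolding s1_def using k by (simp add: add_pos_pos)
  have fs1: "f s1 \<ge> - 1 + s1 * E"
    using energy_lower_bound[OF s1, of k] k s1 unfolding f_def s1_def k_def by (auto simp: algebra_simps)
  obtain d where d: "0 < d" "d < s1" "energy d < - 1 + s1 * E"
    using energy_small_coupling[of "s1 * E" s1] s1 E by auto
  \<comment> \<open>At this point \<open>f R \<le> - (R * E) = - 1 - s1 * E\<close>, below the value
    guaranteed at \<open>s1\<close>.\<close>
  define R where "R = s1 + 1 / E"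
  have "f R \<le> - (R * E)" using energy_nonpos[of R] s1 E unfolding f_def R_def by (simp add: add_pos_pos)
  moreover have "R * E = s1 * E + 1" unfolding R_def using E by (simp add: field_simps)
  ultimately have fR: "f R < f s1" using fs1 s1 E by (smt (verit) mult_pos_pos)
  have fd: "f d < f s1" using fs1 d E unfolding f_def by (smt (verit) mult_pos_pos)
  have dR: "d < s1" "s1 < R" using d E unfolding R_def by auto
  have der: "\<exists>U v. ground_state s U v \<and> (f has_real_derivative kinetic U v - E) (at s)" if "s > 0" for s
  proof -
    obtain U v where g: "ground_state s U v" using ground_state_mathieu[OF \<open>s > 0\<close>] by metis
    then show ?thesis using energy_has_derivative[OF g] unfolding f_def
      by (intro exI conjI) (assumption, auto intro!: derivative_eq_intros)
  qed
  have "continuous_on {d..R} f"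
  proof (rule continuous_at_imp_continuous_on, rule ballI)
    show "isCont f x" if "x \<in> {d..R}" for x using der[of x] that d DERIV_isCont by fastforce
  qed
  then obtain s where s: "s \<in> {d..R}" "\<And>x. x \<in> {d..R} \<Longrightarrow> f x \<le> f s"
    using continuous_attains_sup[of "{d..R}" f] dR by auto
  have "f s1 \<le> f s" using s(2)[of s1] dR by simp
  then have sin: "d < s" "s < R" using fd fR s(1) by (auto simp: less_le)
  obtain U v where g: "ground_state s U v" and D: "(f has_real_derivative kinetic U v - E) (at s)"
    using der[of s] sin d by auto
  have "kinetic U v - E = 0"
  proof (rule DERIV_local_max[OF D, where d = "min (s - d) (R - s)"])
    show "0 < min (s - d) (R - s)" using sin by simp
    show "\<forall>y. \<bar>s - y\<bar> < min (s - d) (R - s) \<longrightarrow> f y \<le> f s" using s(2) by (auto simp: abs_if split: if_splits)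
  qed
  with g show ?thesis by auto
qed

section \<open>Absolutely continuous functions\<close>

abbreviation lebesgue_Icc :: "real \<Rightarrow> real \<Rightarrow> real measure" where
  "lebesgue_Icc a b \<equiv> lebesgue_on {a..b}"

lemma set_integrable_lebesgue_Icc: "set_integrable lebesgue {a..b} f \<longleftrightarrow> integrable (lebesgue_Icc a b) f"
  for a b :: real and f :: "real \<Rightarrow> 'a::{banach, second_countable_topology}"
  by (simp add: set_integrable_def integrable_restrict_space)

lemma LINT_lebesgue_Icc: "(LINT t:{a..b}|lebesgue. f t) = integral\<^sup>L (lebesgue_Icc a b) f"
  for a b :: real and f :: "real \<Rightarrow> 'a::{banach, second_countable_topology}"
  by (simp add: set_lebesgue_integral_def integral_restrict_space)

lemma AE_lebesgue_Icc: "(AE t in lebesgue_Icc a b. P t) \<longleftrightarrow> (AE t in lebesgue. t \<in> {a..b} \<longrightarrow> P t)"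
  by (simp add: AE_restrict_space_iff)

lemma integrable_lebesgue_Icc_subinterval:
  fixes f :: "real \<Rightarrow> complex"
  assumes "integrable (lebesgue_Icc a b) f" "t \<le> b"
  shows "integrable (lebesgue_Icc a t) f"
  using assms set_integrable_subset[of lebesgue "{a..b}" f "{a..t}"]
  by (simp add: set_integrable_lebesgue_Icc)

lemma integrable_lebesgue_Icc_continuous:
  fixes f :: "real \<Rightarrow> 'a::euclidean_space"
  assumes "continuous_on {a..b} f"
  shows "integrable (lebesgue_Icc a b) f"
  using absolutely_integrable_continuous_real[OF assms] by (simp add: set_integrable_lebesgue_Icc)

lemma integral_lebesgue_Icc:
  fixes f :: "real \<Rightarrow> 'a::euclidean_space"
  assumes "integrable (lebesgue_Icc a b) f"
  shows "integral\<^sup>L (lebesgue_Icc a b) f = integral {a..b} f"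
  using assms set_lebesgue_integral_eq_integral(2)[of "{a..b}" f]
  by (simp add: set_integrable_lebesgue_Icc LINT_lebesgue_Icc)

lemma sigma_finite_lebesgue_Icc: "sigma_finite_measure (lebesgue_Icc a b)"
  using finite_measure_lebesgue_on[of "{a..b}"] by (simp add: finite_measure_def)

lemma integral_lebesgue_Icc_truncate:
  fixes f :: "real \<Rightarrow> complex"
  assumes "x \<in> {a..b}"
  shows "(LINT y|lebesgue_Icc a b. (if y \<le> x then f y else 0)) = integral\<^sup>L (lebesgue_Icc a x) f"
proof -
  have "(LINT y|lebesgue_Icc a b. (if y \<le> x then f y else 0)) = (LINT y|lebesgue. indicator {a..b} y *\<^sub>R (if y \<le> x then f y else 0))"
    by (simp add: integral_restrict_space)
  also have "\<dots> = (LINT y|lebesgue. indicator {a..x} y *\<^sub>R f y)"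
    using assms by (intro Bochner_Integration.integral_cong) (auto simp: indicator_def)
  finally show ?thesis by (simp add: integral_restrict_space)
qed

lemma AE_lebesgue_Icc_neq: "AE y in lebesgue_Icc a b. y \<noteq> x"
proof -
  have "AE y in lebesgue. y \<noteq> x" using AE_completion[OF AE_lborel_singleton[of x]] .
  then show ?thesis unfolding AE_lebesgue_Icc by eventually_elim simp
qed

text \<open>The product of two integrals is an integral over a square, cut along the diagonal into
  two triangles whose inner integrals are primitives. This is integration by parts for absolutely
  continuous functions without differentiating almost everywhere.\<close>

lemma lebesgue_Icc_Fubini_triangle:
  fixes f g :: "real \<Rightarrow> complex"
  assumes f: "integrable (lebesgue_Icc a b) f" and g: "integrable (lebesgue_Icc a b) g"
  shows "integrable (lebesgue_Icc a b) (\<lambda>x. f x * integral\<^sup>L (lebesgue_Icc a x) g)"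
    and "integral\<^sup>L (lebesgue_Icc a b) f * integral\<^sup>L (lebesgue_Icc a b) g
      = (LINT x|lebesgue_Icc a b. f x * integral\<^sup>L (lebesgue_Icc a x) g)
        + (LINT x|lebesgue_Icc a b. integral\<^sup>L (lebesgue_Icc a x) f * g x)"
proof -
  define L where "L = lebesgue_Icc a b"
  note fg = f[folded L_def] g[folded L_def]
  interpret L: sigma_finite_measure L unfolding L_def by (rule sigma_finite_lebesgue_Icc)
  interpret P: pair_sigma_finite L L ..
  have space: "space L = {a..b}" unfolding L_def by simp
  have [measurable]: "f \<in> borel_measurable L" "g \<in> borel_measurable L" using fg by auto
  have "(\<lambda>x. x) \<in> borel_measurable (completion lborel :: real measure)"
    by (rule measurable_completion) simp
  then have [measurable]: "(\<lambda>x. x) \<in> borel_measurable L" unfolding L_def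
    by (rule measurable_restrict_space1)
  define H where "H = (\<lambda>(x, y). f x * g y)"
  have [measurable]: "H \<in> borel_measurable (L \<Otimes>\<^sub>M L)" unfolding H_def by measurable
  have H: "integrable (L \<Otimes>\<^sub>M L) H"
  proof (rule P.Fubini_integrable)
    have "integrable L (\<lambda>x. norm (f x) * (LINT y|L. norm (g y)))" using fg by auto
    then show "integrable L (\<lambda>x. LINT y|L. norm (H (x, y)))" unfolding H_def by (simp add: norm_mult)
    show "AE x in L. integrable L (\<lambda>y. H (x, y))" unfolding H_def using fg by auto
  qed measurable
  define H1 where "H1 = (\<lambda>x y. if y \<le> x then f x * g y else 0)"
  \<comment> \<open>The strict inequality keeps the diagonal from being counted twice; for fixed
    \<open>y\<close> the inner integral does not see it, a point being null.\<close>
  define H2 where "H2 = (\<lambda>x y. if x < y then f x * g y else 0)"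
  have [measurable]: "case_prod H1 \<in> borel_measurable (L \<Otimes>\<^sub>M L)" "case_prod H2 \<in> borel_measurable (L \<Otimes>\<^sub>M L)"
    unfolding H1_def H2_def by measurable
  have H1: "integrable (L \<Otimes>\<^sub>M L) (case_prod H1)"
    by (rule Bochner_Integration.integrable_bound[OF H]) (auto simp: H1_def H_def)
  have H2: "integrable (L \<Otimes>\<^sub>M L) (case_prod H2)"
    by (rule Bochner_Integration.integrable_bound[OF H]) (auto simp: H2_def H_def)
  have in1: "(LINT y|L. H1 x y) = f x * integral\<^sup>L (lebesgue_Icc a x) g" if "x \<in> {a..b}" for x
  proof -
    have "(LINT y|L. H1 x y) = (LINT y|L. f x * (if y \<le> x then g y else 0))"
      unfolding H1_def by (intro Bochner_Integration.integral_cong) auto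
    then show ?thesis unfolding L_def by (simp only: integral_mult_right_zero integral_lebesgue_Icc_truncate[OF that])
  qed
  have in2: "(LINT x|L. H2 x y) = integral\<^sup>L (lebesgue_Icc a y) f * g y" if "y \<in> {a..b}" for y
  proof -
    have "(LINT x|L. H2 x y) = (LINT x|L. (if x \<le> y then f x else 0) * g y)"
    proof (rule integral_cong_AE)
      show "AE x in L. H2 x y = (if x \<le> y then f x else 0) * g y"
        using AE_lebesgue_Icc_neq[where a = a and b = b and x = y, folded L_def] unfolding H2_def by eventually_elim auto
    qed (unfold H2_def, measurable)
    then show ?thesis unfolding L_def by (simp only: integral_mult_left_zero integral_lebesgue_Icc_truncate[OF that])
  qed
  have cong1: "integrable L (\<lambda>x. LINT y|L. H1 x y) \<longleftrightarrow> integrable L (\<lambda>x. f x * integral\<^sup>L (lebesgue_Icc a x) g)"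
    by (intro Bochner_Integration.integrable_cong) (auto simp: space in1)
  show "integrable (lebesgue_Icc a b) (\<lambda>x. f x * integral\<^sup>L (lebesgue_Icc a x) g)"
    using P.integrable_fst[OF H1] cong1 unfolding L_def by simp
  have "integral\<^sup>L L f * integral\<^sup>L L g = (LINT x|L. LINT y|L. H (x, y))"
    unfolding H_def by simp
  also have "\<dots> = integral\<^sup>L (L \<Otimes>\<^sub>M L) H" by (rule P.integral_fst'[OF H])
  also have "\<dots> = integral\<^sup>L (L \<Otimes>\<^sub>M L) (\<lambda>p. case_prod H1 p + case_prod H2 p)"
    by (intro Bochner_Integration.integral_cong) (auto simp: H_def H1_def H2_def)
  also have "\<dots> = integral\<^sup>L (L \<Otimes>\<^sub>M L) (case_prod H1) + integral\<^sup>L (L \<Otimes>\<^sub>M L) (case_prod H2)"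
    by (rule Bochner_Integration.integral_add[OF H1 H2])
  also have "integral\<^sup>L (L \<Otimes>\<^sub>M L) (case_prod H1) = (LINT x|L. LINT y|L. H1 x y)"
    using P.integral_fst[OF H1] by simp
  also have "\<dots> = (LINT x|L. f x * integral\<^sup>L (lebesgue_Icc a x) g)"
    by (intro Bochner_Integration.integral_cong) (auto simp: space in1)
  also have "integral\<^sup>L (L \<Otimes>\<^sub>M L) (case_prod H2) = (LINT y|L. LINT x|L. H2 x y)"
    using P.integral_snd[OF H2] by simp
  also have "\<dots> = (LINT x|L. integral\<^sup>L (lebesgue_Icc a x) f * g x)"
    by (intro Bochner_Integration.integral_cong) (auto simp: space in2)
  finally show "integral\<^sup>L (lebesgue_Icc a b) f * integral\<^sup>L (lebesgue_Icc a b) g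
      = (LINT x|lebesgue_Icc a b. f x * integral\<^sup>L (lebesgue_Icc a x) g)
        + (LINT x|lebesgue_Icc a b. integral\<^sup>L (lebesgue_Icc a x) f * g x)"
    unfolding L_def .
qed

text \<open>\<open>F\<close> is absolutely continuous on \<open>[a, b]\<close> with almost everywhere derivative \<open>f\<close>.\<close>

definition primitive_on :: "real \<Rightarrow> real \<Rightarrow> (real \<Rightarrow> complex) \<Rightarrow> (real \<Rightarrow> complex) \<Rightarrow> bool" where
  "primitive_on a b F f \<longleftrightarrow> integrable (lebesgue_Icc a b) f \<and>
     (\<forall>t\<in>{a..b}. F t = F a + integral\<^sup>L (lebesgue_Icc a t) f)"

lemma primitive_on_continuous:
  assumes "primitive_on a b F f"
  shows "continuous_on {a..b} F"
proof -
  have int: "integrable (lebesgue_Icc a b) f" using assms unfolding primitive_on_def by simp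
  then have "f integrable_on {a..b}"
    by (intro set_lebesgue_integral_eq_integral(1) set_integrable_lebesgue_Icc[THEN iffD2])
  then have "continuous_on {a..b} (\<lambda>t. F a + integral {a..t} f)"
    by (intro continuous_intros indefinite_integral_continuous_1)
  moreover have "F t = F a + integral {a..t} f" if "t \<in> {a..b}" for t
  proof -
    have "integral\<^sup>L (lebesgue_Icc a t) f = integral {a..t} f"
      using that by (intro integral_lebesgue_Icc integrable_lebesgue_Icc_subinterval[OF int]) auto
    then show ?thesis using assms that unfolding primitive_on_def by metis
  qed
  ultimately show ?thesis by (rule continuous_on_eq[OF _ sym])
qed

lemma primitive_on_end:
  assumes "primitive_on a b F f" "a \<le> b"
  shows "integral\<^sup>L (lebesgue_Icc a b) f = F b - F a"
proof -
  have "F b = F a + integral\<^sup>L (lebesgue_Icc a b) f" using assms unfolding primitive_on_def by (meson atLeastAtMost_iff order_refl)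
  then show ?thesis by simp
qed

text \<open>Expanding both factors around \<open>a\<close> leaves the product of two integrals as
  the only nonlinear term, and the triangle formula writes it as one integral.\<close>

lemma primitive_on_mult:
  assumes F: "primitive_on a b F f" and G: "primitive_on a b G g"
  shows "primitive_on a b (\<lambda>t. F t * G t) (\<lambda>t. f t * G t + F t * g t)"
proof -
  have f: "integrable (lebesgue_Icc a b) f" and g: "integrable (lebesgue_Icc a b) g"
    and Ft: "\<And>t. t \<in> {a..b} \<Longrightarrow> F t = F a + integral\<^sup>L (lebesgue_Icc a t) f"
    and Gt: "\<And>t. t \<in> {a..b} \<Longrightarrow> G t = G a + integral\<^sup>L (lebesgue_Icc a t) g"
    using F G unfolding primitive_on_def by blast+
  define h where "h t = (f t * G a + f t * integral\<^sup>L (lebesgue_Icc a t) g)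
      + (F a * g t + integral\<^sup>L (lebesgue_Icc a t) f * g t)" for t
  have h_eq: "h t = f t * G t + F t * g t" if "t \<in> {a..b}" for t
    unfolding h_def Ft[OF that] Gt[OF that] by (simp only: distrib_left distrib_right)
  have main: "integrable (lebesgue_Icc a t) h \<and> F t * G t = F a * G a + integral\<^sup>L (lebesgue_Icc a t) h"
    if t: "t \<in> {a..b}" for t
  proof -
    note ft = integrable_lebesgue_Icc_subinterval[OF f, of t] and gt = integrable_lebesgue_Icc_subinterval[OF g, of t]
    have fgt: "integrable (lebesgue_Icc a t) f" "integrable (lebesgue_Icc a t) g" using t ft gt by auto
    note tri = lebesgue_Icc_Fubini_triangle[OF fgt]
    have tri2: "integrable (lebesgue_Icc a t) (\<lambda>x. integral\<^sup>L (lebesgue_Icc a x) f * g x)"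
      using lebesgue_Icc_Fubini_triangle(1)[OF fgt(2) fgt(1)] by (simp add: mult.commute)
    let ?L = "lebesgue_Icc a t"
    have i1: "integrable ?L (\<lambda>t. f t * G a)" and i2: "integrable ?L (\<lambda>t. F a * g t)"
      by (rule integrable_mult_left[OF fgt(1)], rule integrable_mult_right[OF fgt(2)])
    note i3 = Bochner_Integration.integrable_add[OF i1 tri(1)] and i4 = Bochner_Integration.integrable_add[OF i2 tri2]
    have "integrable ?L h" unfolding h_def by (rule Bochner_Integration.integrable_add[OF i3 i4])
    moreover have "integral\<^sup>L ?L h = (integral\<^sup>L ?L f * G a
        + (LINT x|?L. f x * integral\<^sup>L (lebesgue_Icc a x) g))
        + (F a * integral\<^sup>L ?L g + (LINT x|?L. integral\<^sup>L (lebesgue_Icc a x) f * g x))"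
      unfolding h_def Bochner_Integration.integral_add[OF i3 i4] Bochner_Integration.integral_add[OF i1 tri(1)]
        Bochner_Integration.integral_add[OF i2 tri2] by simp
    moreover have "F t * G t = F a * G a + (integral\<^sup>L (lebesgue_Icc a t) f * G a + F a * integral\<^sup>L (lebesgue_Icc a t) g
        + integral\<^sup>L (lebesgue_Icc a t) f * integral\<^sup>L (lebesgue_Icc a t) g)"
      unfolding Ft[OF t] Gt[OF t] by (simp only: distrib_left distrib_right add_ac)
    ultimately show ?thesis unfolding tri(2) by (simp only: add_ac simp_thms)
  qed
  show ?thesis unfolding primitive_on_def
  proof (intro conjI ballI)
    show "integrable (lebesgue_Icc a b) (\<lambda>t. f t * G t + F t * g t)"
    proof (cases "a \<le> b")
      case True
      then have "integrable (lebesgue_Icc a b) h" using main[of b] by simp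
      moreover have "integrable (lebesgue_Icc a b) h \<longleftrightarrow> integrable (lebesgue_Icc a b) (\<lambda>t. f t * G t + F t * g t)"
        by (intro Bochner_Integration.integrable_cong refl) (simp add: h_eq)
      ultimately show ?thesis by simp
    next
      case False
      then show ?thesis by (intro integrable_lebesgue_Icc_continuous) simp
    qed
    fix t assume t: "t \<in> {a..b}"
    have "integral\<^sup>L (lebesgue_Icc a t) h = (LINT x|lebesgue_Icc a t. f x * G x + F x * g x)"
      by (intro Bochner_Integration.integral_cong refl) (use t in \<open>simp add: h_eq\<close>)
    then show "F t * G t = F a * G a + (LINT x|lebesgue_Icc a t. f x * G x + F x * g x)"
      using main[OF t] by simp
  qed
qed

lemma primitive_on_cnj:
  assumes "primitive_on a b F f"
  shows "primitive_on a b (\<lambda>t. cnj (F t)) (\<lambda>t. cnj (f t))"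
  unfolding primitive_on_def
proof (intro conjI ballI)
  show "integrable (lebesgue_Icc a b) (\<lambda>t. cnj (f t))"
    using assms unfolding primitive_on_def by simp
  fix t assume "t \<in> {a..b}"
  then have "F t = F a + integral\<^sup>L (lebesgue_Icc a t) f" using assms unfolding primitive_on_def by blast
  then show "cnj (F t) = cnj (F a) + integral\<^sup>L (lebesgue_Icc a t) (\<lambda>t. cnj (f t))" by simp
qed

lemma primitive_on_deriv:
  fixes F :: "real \<Rightarrow> complex"
  assumes F: "\<And>x. (F has_vector_derivative f x) (at x)" and f: "continuous_on UNIV f"
  shows "primitive_on a b F f"
  unfolding primitive_on_def
proof (intro conjI ballI)
  have fc: "continuous_on S f" for S using f continuous_on_subset by blast
  show "integrable (lebesgue_Icc a b) f" by (intro integrable_lebesgue_Icc_continuous fc)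
  fix t assume "t \<in> {a..b}"
  then have "(f has_integral (F t - F a)) {a..t}"
    by (intro fundamental_theorem_of_calculus) (auto intro: F has_vector_derivative_at_within)
  then show "F t = F a + integral\<^sup>L (lebesgue_Icc a t) f"
    using integral_lebesgue_Icc[OF integrable_lebesgue_Icc_continuous[OF fc], of a t] by (simp add: integral_unique)
qed

lemma primitive_on_constant:
  assumes F: "primitive_on a b F f" and z: "AE t in lebesgue_Icc a b. f t = 0" and t: "t \<in> {a..b}"
  shows "F t = F a"
proof -
  have "AE s in lebesgue_Icc a t. f s = 0"
    using z t unfolding AE_lebesgue_Icc by (auto elim: eventually_mono)
  then have "integral\<^sup>L (lebesgue_Icc a t) f = 0" by (rule integral_eq_zero_AE)
  moreover have "F t = F a + integral\<^sup>L (lebesgue_Icc a t) f" using F t unfolding primitive_on_def by blast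
  ultimately show ?thesis by simp
qed

section \<open>States on the circle\<close>

abbreviation circle_measure :: "real measure" where
  "circle_measure \<equiv> lebesgue_Icc (- pi) pi"

lemma L2p_iff: "L2p \<phi> \<longleftrightarrow> \<phi> \<in> borel_measurable circle_measure \<and> integrable circle_measure (\<lambda>t. (cmod (\<phi> t))\<^sup>2)"
  unfolding L2p_def set_borel_measurable_def set_integrable_lebesgue_Icc
  by (simp add: borel_measurable_restrict_space_iff)

lemma continuous_borel_measurable_circle:
  fixes f :: "real \<Rightarrow> 'a::euclidean_space"
  assumes "continuous_on {-pi..pi} f"
  shows "f \<in> borel_measurable circle_measure"
  using integrable_lebesgue_Icc_continuous[OF assms] by (rule borel_measurable_integrable)

lemma square_integrable_imp_integrable:
  fixes g :: "real \<Rightarrow> complex"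
  assumes "g \<in> borel_measurable circle_measure" "integrable circle_measure (\<lambda>t. (cmod (g t))\<^sup>2)"
  shows "integrable circle_measure g"
proof (rule Bochner_Integration.integrable_bound)
  have "integrable circle_measure (\<lambda>t. 1 :: real)" by (intro integrable_lebesgue_Icc_continuous) simp
  then show "integrable circle_measure (\<lambda>t. 1 + (cmod (g t))\<^sup>2)"
    by (rule Bochner_Integration.integrable_add) (rule assms(2))
  show "AE t in circle_measure. norm (g t) \<le> norm (1 + (cmod (g t))\<^sup>2)"
  proof (rule AE_I2)
    fix t
    have "2 * cmod (g t) \<le> 1 + (cmod (g t))\<^sup>2" using sum_squares_bound[of 1 "cmod (g t)"] by simp
    then have "cmod (g t) \<le> 1 + (cmod (g t))\<^sup>2" using norm_ge_zero[of "g t"] by linarith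
    then show "norm (g t) \<le> norm (1 + (cmod (g t))\<^sup>2)" by simp
  qed
qed (rule assms(1))

text \<open>States matter only up to null sets, whereas boundary values and the product rule need
  the continuous representative \<open>\<Phi>\<close>.\<close>

lemma deriv_rep_primitive:
  assumes "deriv_rep \<phi> g"
  shows "L2p g" "\<exists>\<Phi>. primitive_on (- pi) pi \<Phi> g \<and> \<Phi> pi = \<Phi> (- pi) \<and> (AE t in circle_measure. \<phi> t = \<Phi> t)"
proof -
  show L: "L2p g" using assms unfolding deriv_rep_def by simp
  obtain c where z: "integral\<^sup>L circle_measure g = 0"
    and ae: "AE t in circle_measure. \<phi> t = c + integral\<^sup>L (lebesgue_Icc (- pi) t) g"
    using assms unfolding deriv_rep_def LINT_lebesgue_Icc AE_lebesgue_Icc by blast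
  define \<Phi> where "\<Phi> t = c + integral\<^sup>L (lebesgue_Icc (- pi) t) g" for t
  \<comment> \<open>A single point is null, so the constant \<open>c\<close> is the value of
    \<open>\<Phi>\<close> at \<open>- pi\<close>.\<close>
  have "AE t in lebesgue_Icc (- pi) (- pi). g t = 0"
    using AE_lebesgue_Icc_neq[where a = "-pi" and b = "-pi" and x = "-pi"] AE_space
    by eventually_elim auto
  then have "integral\<^sup>L (lebesgue_Icc (- pi) (- pi)) g = 0" by (rule integral_eq_zero_AE)
  then have "\<Phi> (- pi) = c" unfolding \<Phi>_def by (simp only: add_0_right)
  then have "primitive_on (- pi) pi \<Phi> g" "\<Phi> pi = \<Phi> (- pi)"
    unfolding primitive_on_def using L z
    by (auto simp: L2p_iff \<Phi>_def intro: square_integrable_imp_integrable)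
  then show "\<exists>\<Phi>. primitive_on (- pi) pi \<Phi> g \<and> \<Phi> pi = \<Phi> (- pi) \<and> (AE t in circle_measure. \<phi> t = \<Phi> t)"
    using ae unfolding \<Phi>_def[symmetric] by blast
qed

lemma primitive_on_of_real:
  assumes "\<And>x. (f has_real_derivative f' x) (at x)" "continuous_on UNIV f'"
  shows "primitive_on a b (\<lambda>t. complex_of_real (f t)) (\<lambda>t. complex_of_real (f' t))"
  using assms
  by (intro primitive_on_deriv continuous_intros has_vector_derivative_of_real)
    (auto simp: has_real_derivative_iff_has_vector_derivative)

section \<open>Barta's identity for weakly differentiable states\<close>

text \<open>\<open>- i g - p z\<close> has the modulus of \<open>g - i p z\<close>, and the square
  is completed with \<open>v z\<close>. The product of \<open>i p z\<close> with the conjugate of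
  \<open>v z\<close> is imaginary, so the last summand is free of \<open>p\<close>: for a state it
  is the derivative of \<open>v * |\<phi>|^2\<close>.\<close>

lemma barta_identity_pointwise:
  fixes z g :: complex and v v' p :: real
  shows "(cmod (- \<i> * g - complex_of_real p * z))\<^sup>2 = (- v' - v\<^sup>2) * (cmod z)\<^sup>2
    + (cmod (g - (\<i> * complex_of_real p + complex_of_real v) * z))\<^sup>2
    + Re (complex_of_real v' * (cnj z * z) + complex_of_real v * (cnj g * z + cnj z * g))"
  unfolding cmod_power2 by (simp add: power2_eq_square algebra_simps)

text \<open>The last summand of the pointwise identity integrates to zero by the product rule for
  primitives and periodicity.\<close>

lemma weak_barta_identity:
  assumes \<Phi>: "primitive_on (- pi) pi \<Phi> g" and per: "\<Phi> pi = \<Phi> (- pi)" and g: "L2p g"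
    and v: "\<And>x. (v has_real_derivative v' x) (at x)" and v'c: "continuous_on UNIV v'" and vper: "v pi = v (- pi)"
  shows "integrable circle_measure (\<lambda>t. (cmod (g t - (\<i> * complex_of_real p + complex_of_real (v t)) * \<Phi> t))\<^sup>2)"
    and "(LINT t|circle_measure. (cmod (- \<i> * g t - complex_of_real p * \<Phi> t))\<^sup>2)
      = (LINT t|circle_measure. (- v' t - (v t)\<^sup>2) * (cmod (\<Phi> t))\<^sup>2)
      + (LINT t|circle_measure. (cmod (g t - (\<i> * complex_of_real p + complex_of_real (v t)) * \<Phi> t))\<^sup>2)"
proof -
  let ?L = circle_measure
  have [continuous_intros]: "continuous_on {-pi..pi} \<Phi>" "continuous_on {-pi..pi} v" "continuous_on {-pi..pi} v'"
    using primitive_on_continuous[OF \<Phi>] continuous_on_if_deriv[OF v] v'c continuous_on_subset by blast+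
  define d where "d t = g t - (\<i> * complex_of_real p + complex_of_real (v t)) * \<Phi> t" for t
  define b where "b t = (\<i> * complex_of_real p + complex_of_real (v t)) * \<Phi> t" for t
  have bc: "continuous_on {-pi..pi} b" unfolding b_def by (intro continuous_intros)
  have gm [measurable]: "g \<in> borel_measurable ?L" and g2: "integrable ?L (\<lambda>t. (cmod (g t))\<^sup>2)"
    using g unfolding L2p_iff by auto
  have bm [measurable]: "b \<in> borel_measurable ?L" by (rule continuous_borel_measurable_circle[OF bc])
  have d_eq: "d = (\<lambda>t. g t - b t)" unfolding d_def b_def ..
  have d2: "integrable ?L (\<lambda>t. (cmod (d t))\<^sup>2)"
  proof (rule Bochner_Integration.integrable_bound)
    have "integrable ?L (\<lambda>t. (cmod (b t))\<^sup>2)" by (intro integrable_lebesgue_Icc_continuous continuous_intros bc)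
    then show "integrable ?L (\<lambda>t. 2 * (cmod (g t))\<^sup>2 + 2 * (cmod (b t))\<^sup>2)"
      using g2 by (intro Bochner_Integration.integrable_add integrable_mult_right) auto
    show "(\<lambda>t. (cmod (d t))\<^sup>2) \<in> borel_measurable ?L" unfolding d_eq by measurable
    show "AE t in ?L. norm ((cmod (d t))\<^sup>2) \<le> norm (2 * (cmod (g t))\<^sup>2 + 2 * (cmod (b t))\<^sup>2)"
    proof (rule AE_I2)
      fix t
      have "cmod (d t) \<le> cmod (g t) + cmod (b t)" unfolding d_eq by (rule norm_triangle_ineq4)
      then have "(cmod (d t))\<^sup>2 \<le> (cmod (g t) + cmod (b t))\<^sup>2" by (intro power_mono) auto
      also have "\<dots> \<le> 2 * (cmod (g t))\<^sup>2 + 2 * (cmod (b t))\<^sup>2"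
        using sum_squares_bound[of "cmod (g t)" "cmod (b t)"] by (simp add: power2_sum)
      finally show "norm ((cmod (d t))\<^sup>2) \<le> norm (2 * (cmod (g t))\<^sup>2 + 2 * (cmod (b t))\<^sup>2)" by simp
    qed
  qed
  then show "integrable ?L (\<lambda>t. (cmod (g t - (\<i> * complex_of_real p + complex_of_real (v t)) * \<Phi> t))\<^sup>2)"
    unfolding d_def .
  define e where "e t = complex_of_real (v' t) * (cnj (\<Phi> t) * \<Phi> t)
      + complex_of_real (v t) * (cnj (g t) * \<Phi> t + cnj (\<Phi> t) * g t)" for t
  have e: "primitive_on (- pi) pi (\<lambda>t. complex_of_real (v t) * (cnj (\<Phi> t) * \<Phi> t)) e"
    unfolding e_def
    by (intro primitive_on_mult primitive_on_of_real primitive_on_cnj \<Phi> v v'c)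
  then have ei: "integrable ?L e" unfolding primitive_on_def by simp
  have e0: "integral\<^sup>L ?L e = 0" using primitive_on_end[OF e] per vper by simp
  have k: "integrable ?L (\<lambda>t. (- v' t - (v t)\<^sup>2) * (cmod (\<Phi> t))\<^sup>2)"
    by (intro integrable_lebesgue_Icc_continuous continuous_intros)
  have "(LINT t|?L. (cmod (- \<i> * g t - complex_of_real p * \<Phi> t))\<^sup>2)
    = (LINT t|?L. (- v' t - (v t)\<^sup>2) * (cmod (\<Phi> t))\<^sup>2 + (cmod (d t))\<^sup>2 + Re (e t))"
    unfolding d_def e_def barta_identity_pointwise[symmetric] ..
  also have "\<dots> = (LINT t|?L. (- v' t - (v t)\<^sup>2) * (cmod (\<Phi> t))\<^sup>2) + (LINT t|?L. (cmod (d t))\<^sup>2) + (LINT t|?L. Re (e t))"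
    using Bochner_Integration.integral_add[OF Bochner_Integration.integrable_add[OF k d2] integrable_Re[OF ei]]
      Bochner_Integration.integral_add[OF k d2] by simp
  also have "(LINT t|?L. Re (e t)) = 0" using integral_Re[OF ei] e0 by simp
  finally show "(LINT t|?L. (cmod (- \<i> * g t - complex_of_real p * \<Phi> t))\<^sup>2)
      = (LINT t|?L. (- v' t - (v t)\<^sup>2) * (cmod (\<Phi> t))\<^sup>2)
      + (LINT t|?L. (cmod (g t - (\<i> * complex_of_real p + complex_of_real (v t)) * \<Phi> t))\<^sup>2)"
    unfolding d_def by simp
qed

section \<open>Unit states and their means of cosine and sine\<close>

lemma unit_state_norm:
  assumes "unit_state \<phi>"
  shows "\<phi> \<in> borel_measurable circle_measure" "integrable circle_measure (\<lambda>t. (cmod (\<phi> t))\<^sup>2)"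
    "(LINT t|circle_measure. (cmod (\<phi> t))\<^sup>2) = 2 * pi"
proof -
  show "\<phi> \<in> borel_measurable circle_measure" "integrable circle_measure (\<lambda>t. (cmod (\<phi> t))\<^sup>2)"
    using assms unfolding unit_state_def L2p_iff by auto
  have "(LINT t|circle_measure. cnj (\<phi> t) * \<phi> t) = complex_of_real (2 * pi)"
    using assms unfolding unit_state_def ip_def LINT_lebesgue_Icc by simp
  moreover have "cnj (\<phi> t) * \<phi> t = complex_of_real ((cmod (\<phi> t))\<^sup>2)" for t
    by (metis complex_norm_square mult.commute)
  ultimately have "complex_of_real (LINT t|circle_measure. (cmod (\<phi> t))\<^sup>2) = complex_of_real (2 * pi)"
    by (simp only: integral_complex_of_real)
  then show "(LINT t|circle_measure. (cmod (\<phi> t))\<^sup>2) = 2 * pi" using of_real_eq_iff by blast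
qed

lemma bounded_mult_integrable:
  fixes f h :: "real \<Rightarrow> real"
  assumes "integrable circle_measure h" "continuous_on {-pi..pi} f" "\<And>t. \<bar>f t\<bar> \<le> 1"
  shows "integrable circle_measure (\<lambda>t. f t * h t)"
proof (rule Bochner_Integration.integrable_bound[OF assms(1)])
  show "(\<lambda>t. f t * h t) \<in> borel_measurable circle_measure"
    using assms(1) continuous_borel_measurable_circle[OF assms(2)] by measurable
  show "AE t in circle_measure. norm (f t * h t) \<le> norm (h t)"
    using assms(3) by (intro AE_I2) (simp add: abs_mult mult_left_le_one_le)
qed

lemma var_mult_eq:
  assumes \<phi>: "unit_state \<phi>" and f: "continuous_on {-pi..pi} f" "\<And>t. \<bar>f t\<bar> \<le> 1"
  shows "var_mult f \<phi> = expect_mult (\<lambda>t. (f t)\<^sup>2) \<phi> - (expect_mult f \<phi>)\<^sup>2"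
proof -
  note n = unit_state_norm[OF \<phi>]
  define e where "e = expect_mult f \<phi>"
  have i1: "integrable circle_measure (\<lambda>t. f t * (cmod (\<phi> t))\<^sup>2)"
    by (rule bounded_mult_integrable[OF n(2) f])
  have i2: "integrable circle_measure (\<lambda>t. (f t)\<^sup>2 * (cmod (\<phi> t))\<^sup>2)"
    using f by (intro bounded_mult_integrable n(2) continuous_intros) (auto simp: abs_square_le_1)
  have "(LINT t|circle_measure. (f t - e)\<^sup>2 * (cmod (\<phi> t))\<^sup>2)
    = (LINT t|circle_measure. (f t)\<^sup>2 * (cmod (\<phi> t))\<^sup>2 - (2 * e) * (f t * (cmod (\<phi> t))\<^sup>2) + e\<^sup>2 * (cmod (\<phi> t))\<^sup>2)"
    by (intro Bochner_Integration.integral_cong refl) (simp add: power2_eq_square algebra_simps)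
  also have "\<dots> = (LINT t|circle_measure. (f t)\<^sup>2 * (cmod (\<phi> t))\<^sup>2)
      - (2 * e) * (LINT t|circle_measure. f t * (cmod (\<phi> t))\<^sup>2) + e\<^sup>2 * (2 * pi)"
    using i1 i2 n(2,3) by simp
  also have "(LINT t|circle_measure. f t * (cmod (\<phi> t))\<^sup>2) = e * (2 * pi)"
    unfolding e_def expect_mult_def LINT_lebesgue_Icc by simp
  finally show ?thesis
    unfolding var_mult_def e_def[symmetric] LINT_lebesgue_Icc
    unfolding expect_mult_def LINT_lebesgue_Icc by (simp add: field_simps power2_eq_square)
qed

lemma var_cos_sin_eq:
  assumes "unit_state \<phi>"
  shows "var_cos_sin \<phi> = 1 - (expect_mult cos \<phi>)\<^sup>2 - (expect_mult sin \<phi>)\<^sup>2"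
proof -
  note n = unit_state_norm[OF assms]
  have c: "continuous_on {-pi..pi} (cos :: real \<Rightarrow> real)" "continuous_on {-pi..pi} (sin :: real \<Rightarrow> real)"
    by (intro continuous_intros)+
  have i: "integrable circle_measure (\<lambda>t. (cos t)\<^sup>2 * (cmod (\<phi> t))\<^sup>2)"
    "integrable circle_measure (\<lambda>t. (sin t)\<^sup>2 * (cmod (\<phi> t))\<^sup>2)"
    by (intro bounded_mult_integrable n(2) continuous_intros; simp add: abs_square_le_1)+
  have "expect_mult (\<lambda>t. (cos t)\<^sup>2) \<phi> + expect_mult (\<lambda>t. (sin t)\<^sup>2) \<phi>
    = (LINT t|circle_measure. (cos t)\<^sup>2 * (cmod (\<phi> t))\<^sup>2 + (sin t)\<^sup>2 * (cmod (\<phi> t))\<^sup>2) / (2 * pi)"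
    unfolding expect_mult_def LINT_lebesgue_Icc Bochner_Integration.integral_add[OF i] by (rule add_divide_distrib[symmetric])
  also have "\<dots> = 1" unfolding distrib_right[symmetric] using n(3) by simp
  finally show ?thesis
    unfolding var_cos_sin_def using var_mult_eq[OF assms c(1)] var_mult_eq[OF assms c(2)] by simp
qed

lemma expect_cos_shift:
  assumes "unit_state \<phi>"
  shows "integrable circle_measure (\<lambda>t. cos (t - a) * (cmod (\<phi> t))\<^sup>2)"
    "(LINT t|circle_measure. cos (t - a) * (cmod (\<phi> t))\<^sup>2)
      = 2 * pi * (cos a * expect_mult cos \<phi> + sin a * expect_mult sin \<phi>)"
proof -
  note n = unit_state_norm[OF assms]
  have i: "integrable circle_measure (\<lambda>t. cos t * (cmod (\<phi> t))\<^sup>2)"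
    "integrable circle_measure (\<lambda>t. sin t * (cmod (\<phi> t))\<^sup>2)"
    by (intro bounded_mult_integrable n(2) continuous_intros; simp)+
  show "integrable circle_measure (\<lambda>t. cos (t - a) * (cmod (\<phi> t))\<^sup>2)"
    by (intro bounded_mult_integrable n(2) continuous_intros; simp)
  have "(LINT t|circle_measure. cos (t - a) * (cmod (\<phi> t))\<^sup>2)
    = (LINT t|circle_measure. cos a * (cos t * (cmod (\<phi> t))\<^sup>2) + sin a * (sin t * (cmod (\<phi> t))\<^sup>2))"
    by (intro Bochner_Integration.integral_cong refl) (simp add: cos_diff algebra_simps)
  also have "\<dots> = cos a * (LINT t|circle_measure. cos t * (cmod (\<phi> t))\<^sup>2) + sin a * (LINT t|circle_measure. sin t * (cmod (\<phi> t))\<^sup>2)"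
    using i by simp
  finally show "(LINT t|circle_measure. cos (t - a) * (cmod (\<phi> t))\<^sup>2)
      = 2 * pi * (cos a * expect_mult cos \<phi> + sin a * expect_mult sin \<phi>)"
    unfolding expect_mult_def LINT_lebesgue_Icc by (simp add: algebra_simps)
qed

section \<open>Optimal states\<close>

lemma ground_state_shift:
  assumes "ground_state s U v"
  shows "((\<lambda>t. U (t - a)) has_real_derivative v (x - a)) (at x)"
    "((\<lambda>t. v (t - a)) has_real_derivative (- (energy s + cos (x - a)) / s - (v (x - a))\<^sup>2)) (at x)"
    "v (pi - a) = v (- pi - a)" "U (pi - a) = U (- pi - a)"
    "continuous_on S (\<lambda>t. U (t - a))" "continuous_on S (\<lambda>t. v (t - a))"
proof -
  note g = ground_stateD[OF assms]
  show U: "((\<lambda>t. U (t - a)) has_real_derivative v (x - a)) (at x)" for x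
    using deriv_shift_add[OF g(2), of "- a" x] by simp
  show v: "((\<lambda>t. v (t - a)) has_real_derivative (- (energy s + cos (x - a)) / s - (v (x - a))\<^sup>2)) (at x)" for x
    using deriv_shift_add[OF g(3), of "- a" x] by simp
  show "v (pi - a) = v (- pi - a)" "U (pi - a) = U (- pi - a)"
    using g(5)[of "- pi - a"] g(7)[of "- pi - a"] by (simp_all add: algebra_simps)
  show "continuous_on S (\<lambda>t. U (t - a))" "continuous_on S (\<lambda>t. v (t - a))"
    using continuous_on_if_deriv[OF U] continuous_on_if_deriv[OF v] by blast+
qed

text \<open>The Riccati equation of the translated ground state turns the local term of
  \<open>weak_barta_identity\<close> into \<open>(energy s + cos (t - a)) / s\<close>. The identity
  holds for the continuous representative and is carried over to \<open>\<phi>\<close> almost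
  everywhere.\<close>

lemma weak_ground_identity:
  assumes gs: "ground_state s U v" and \<phi>: "unit_state \<phi>" and rep: "deriv_rep \<phi> g"
  shows "integrable circle_measure (\<lambda>t. (cmod (g t - (\<i> * complex_of_real p + complex_of_real (v (t - a))) * \<phi> t))\<^sup>2)"
    and "s * (LINT t|circle_measure. (cmod (- \<i> * g t - complex_of_real p * \<phi> t))\<^sup>2)
        - (LINT t|circle_measure. cos (t - a) * (cmod (\<phi> t))\<^sup>2)
      = 2 * pi * energy s
        + s * (LINT t|circle_measure. (cmod (g t - (\<i> * complex_of_real p + complex_of_real (v (t - a))) * \<phi> t))\<^sup>2)"
proof -
  let ?L = circle_measure
  note G = ground_stateD[OF gs] and S = ground_state_shift[OF gs, where a = a]
  note n = unit_state_norm[OF \<phi>]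
  have g: "L2p g" using deriv_rep_primitive(1)[OF rep] .
  then have [measurable]: "g \<in> borel_measurable ?L" unfolding L2p_iff by simp
  obtain \<Phi> where \<Phi>: "primitive_on (- pi) pi \<Phi> g" "\<Phi> pi = \<Phi> (- pi)" and ae: "AE t in ?L. \<phi> t = \<Phi> t"
    using deriv_rep_primitive(2)[OF rep] by blast
  have [measurable]: "\<Phi> \<in> borel_measurable ?L" "\<phi> \<in> borel_measurable ?L"
    using continuous_borel_measurable_circle[OF primitive_on_continuous[OF \<Phi>(1)]] n(1) by auto
  have [measurable]: "(\<lambda>t. v (t - a)) \<in> borel_measurable ?L"
    "(\<lambda>t. cos (t - a)) \<in> borel_measurable ?L"
    by (intro continuous_borel_measurable_circle continuous_intros S)+
  define w' where "w' t = - (energy s + cos (t - a)) / s - (v (t - a))\<^sup>2" for t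
  have w'c: "continuous_on UNIV w'" unfolding w'_def
    using G(1) by (intro continuous_intros S) auto
  note B = weak_barta_identity[OF \<Phi> g S(2)[folded w'_def] w'c S(3), of p]
  have a1: "integrable ?L (\<lambda>t. (cmod (g t - (\<i> * complex_of_real p + complex_of_real (v (t - a))) * \<phi> t))\<^sup>2)
     \<longleftrightarrow> integrable ?L (\<lambda>t. (cmod (g t - (\<i> * complex_of_real p + complex_of_real (v (t - a))) * \<Phi> t))\<^sup>2)"
    by (rule integrable_cong_AE) (measurable, use ae in \<open>eventually_elim, simp\<close>)
  with B(1) show "integrable ?L (\<lambda>t. (cmod (g t - (\<i> * complex_of_real p + complex_of_real (v (t - a))) * \<phi> t))\<^sup>2)"
    by simp
  have a2: "(LINT t|?L. (cmod (g t - (\<i> * complex_of_real p + complex_of_real (v (t - a))) * \<phi> t))\<^sup>2)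
     = (LINT t|?L. (cmod (g t - (\<i> * complex_of_real p + complex_of_real (v (t - a))) * \<Phi> t))\<^sup>2)"
    by (rule integral_cong_AE) (measurable, use ae in \<open>eventually_elim, simp\<close>)
  have a3: "(LINT t|?L. (cmod (- \<i> * g t - complex_of_real p * \<phi> t))\<^sup>2)
     = (LINT t|?L. (cmod (- \<i> * g t - complex_of_real p * \<Phi> t))\<^sup>2)"
    by (rule integral_cong_AE) (measurable, use ae in \<open>eventually_elim, simp\<close>)
  have "(LINT t|?L. (- w' t - (v (t - a))\<^sup>2) * (cmod (\<Phi> t))\<^sup>2) = (LINT t|?L. (energy s + cos (t - a)) / s * (cmod (\<Phi> t))\<^sup>2)"
    unfolding w'_def riccati_cancel ..
  also have "\<dots> = (LINT t|?L. (energy s / s) * (cmod (\<phi> t))\<^sup>2 + (1 / s) * (cos (t - a) * (cmod (\<phi> t))\<^sup>2))"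
  proof (rule integral_cong_AE)
    show "(\<lambda>t. (energy s + cos (t - a)) / s * (cmod (\<Phi> t))\<^sup>2) \<in> borel_measurable ?L"
      using G(1)
      by (intro continuous_borel_measurable_circle continuous_intros primitive_on_continuous[OF \<Phi>(1)]) auto
    show "(\<lambda>t. energy s / s * (cmod (\<phi> t))\<^sup>2 + 1 / s * (cos (t - a) * (cmod (\<phi> t))\<^sup>2)) \<in> borel_measurable ?L"
      by (intro borel_measurable_integrable Bochner_Integration.integrable_add integrable_mult_right
          n(2) expect_cos_shift(1)[OF \<phi>])
    show "AE t in ?L. (energy s + cos (t - a)) / s * (cmod (\<Phi> t))\<^sup>2
        = energy s / s * (cmod (\<phi> t))\<^sup>2 + 1 / s * (cos (t - a) * (cmod (\<phi> t))\<^sup>2)"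
      using ae by eventually_elim (simp add: add_divide_distrib distrib_right)
  qed
  also have "\<dots> = energy s / s * (2 * pi) + (1 / s) * (LINT t|?L. cos (t - a) * (cmod (\<phi> t))\<^sup>2)"
    using n expect_cos_shift(1)[OF \<phi>, of a] by simp
  finally have a4: "s * (LINT t|?L. (- w' t - (v (t - a))\<^sup>2) * (cmod (\<Phi> t))\<^sup>2)
     = 2 * pi * energy s + (LINT t|?L. cos (t - a) * (cmod (\<phi> t))\<^sup>2)"
    using G(1) by (simp add: field_simps)
  show "s * (LINT t|?L. (cmod (- \<i> * g t - complex_of_real p * \<phi> t))\<^sup>2)
        - (LINT t|?L. cos (t - a) * (cmod (\<phi> t))\<^sup>2)
      = 2 * pi * energy s
        + s * (LINT t|?L. (cmod (g t - (\<i> * complex_of_real p + complex_of_real (v (t - a))) * \<phi> t))\<^sup>2)"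
    unfolding a2 a3 B(2) distrib_left a4 by simp
qed

lemma phase_exists: "\<exists>a. cos a * x + sin a * y = sqrt (x\<^sup>2 + y\<^sup>2)"
proof -
  define z where "z = Complex x y"
  define r where "r = sqrt (x\<^sup>2 + y\<^sup>2)"
  have "z = rcis (cmod z) (Arg z)" by (simp add: rcis_cmod_Arg)
  moreover have "cmod z = r" by (simp add: z_def r_def complex_norm)
  ultimately have xy: "x = r * cos (Arg z)" "y = r * sin (Arg z)"
    by (metis Re_rcis complex.sel(1) z_def, metis Im_rcis complex.sel(2) z_def)
  have "cos (Arg z) * (r * cos (Arg z)) + sin (Arg z) * (r * sin (Arg z)) = r * ((cos (Arg z))\<^sup>2 + (sin (Arg z))\<^sup>2)"
    by algebra
  also have "\<dots> = r" by simp
  finally have "cos (Arg z) * x + sin (Arg z) * y = r" by (simp only: xy[symmetric])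
  then show ?thesis unfolding r_def by blast
qed

text \<open>With \<open>a\<close> the angle of the vector of means and \<open>p\<close> the mean
  momentum, the left side of \<open>weak_ground_identity\<close> consists of the momentum variance
  and the length of that vector. As \<open>kinetic U v = E\<close>, the bound
  \<open>s * E - energy s\<close> is \<open>mean_cos U\<close>. The remainder stays for the equality
  case.\<close>

lemma state_bound:
  assumes gs: "ground_state s U v" and kin: "kinetic U v = E"
    and \<phi>: "unit_state \<phi>" and rep: "deriv_rep \<phi> g" and var: "momentum_var \<phi> g \<le> E"
  shows "\<exists>a p. sqrt ((expect_mult cos \<phi>)\<^sup>2 + (expect_mult sin \<phi>)\<^sup>2)
     + s / (2 * pi) * (LINT t|circle_measure. (cmod (g t - (\<i> * complex_of_real p + complex_of_real (v (t - a))) * \<phi> t))\<^sup>2)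
     \<le> mean_cos U"
proof -
  define R where "R = sqrt ((expect_mult cos \<phi>)\<^sup>2 + (expect_mult sin \<phi>)\<^sup>2)"
  obtain a where a: "cos a * expect_mult cos \<phi> + sin a * expect_mult sin \<phi> = R"
    unfolding R_def using phase_exists by blast
  define p where "p = Re (ip \<phi> (\<lambda>t. - \<i> * g t))"
  define J where "J = (LINT t|circle_measure. (cmod (g t - (\<i> * complex_of_real p + complex_of_real (v (t - a))) * \<phi> t))\<^sup>2)"
  define K where "K = (LINT t|circle_measure. (cmod (- \<i> * g t - complex_of_real p * \<phi> t))\<^sup>2)"
  have s: "s > 0" using ground_stateD(1)[OF gs] .
  have "K \<le> 2 * pi * E"
    using var unfolding momentum_var_def Let_def p_def[symmetric] LINT_lebesgue_Icc K_def[symmetric]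
    by (simp add: field_simps)
  then have "s * K \<le> s * (2 * pi * E)" using s by simp
  moreover have "s * K - 2 * pi * R = 2 * pi * energy s + s * J"
    using weak_ground_identity(2)[OF gs \<phi> rep, of p a] expect_cos_shift(2)[OF \<phi>, of a] a
    unfolding K_def J_def by simp
  moreover have "2 * pi * mean_cos U = s * (2 * pi * E) - 2 * pi * energy s"
    unfolding ground_energy[OF gs, symmetric] kin by (simp add: algebra_simps)
  ultimately have "2 * pi * R + s * J \<le> 2 * pi * mean_cos U" by linarith
  then have "R + s / (2 * pi) * J \<le> mean_cos U" by (simp add: field_simps)
  then show ?thesis unfolding R_def J_def by blast
qed

lemma cis_has_vector_derivative:
  "((\<lambda>t. cis (p * t)) has_vector_derivative \<i> * complex_of_real p * cis (p * x)) (at x)"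
  unfolding has_vector_derivative_complex_iff
  by (auto intro!: derivative_eq_intros)

lemma equality_form:
  assumes gs: "ground_state s U v" and \<phi>: "unit_state \<phi>" and rep: "deriv_rep \<phi> g"
    and z: "(LINT t|circle_measure. (cmod (g t - (\<i> * complex_of_real p + complex_of_real (v (t - a))) * \<phi> t))\<^sup>2) = 0"
  shows "\<exists>c (k::int). AE t in circle_measure. \<phi> t = c * cis (of_int k * t) * complex_of_real (exp (U (t - a)))"
proof -
  let ?L = circle_measure
  note G = ground_stateD[OF gs] and S = ground_state_shift[OF gs, where a = a]
  obtain \<Phi> where \<Phi>: "primitive_on (- pi) pi \<Phi> g" "\<Phi> pi = \<Phi> (- pi)" and ae: "AE t in ?L. \<phi> t = \<Phi> t"
    using deriv_rep_primitive(2)[OF rep] by blast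
  have "AE t in ?L. (cmod (g t - (\<i> * complex_of_real p + complex_of_real (v (t - a))) * \<phi> t))\<^sup>2 = 0"
    using integral_nonneg_eq_0_iff_AE[OF weak_ground_identity(1)[OF gs \<phi> rep, of p a]] z by simp
  then have ode: "AE t in ?L. g t = (\<i> * complex_of_real p + complex_of_real (v (t - a))) * \<Phi> t"
    using ae by eventually_elim simp
  define e where "e t = exp (- U (t - a))" for t
  have e: "(e has_real_derivative - v (t - a) * e t) (at t)" for t
    unfolding e_def by (auto intro!: derivative_eq_intros S)
  have Qe: "primitive_on (- pi) pi (\<lambda>t. complex_of_real (e t)) (\<lambda>t. complex_of_real (- v (t - a) * e t))"
    by (rule primitive_on_of_real[OF e]) (intro continuous_intros S continuous_on_if_deriv[OF e])
  have Qc: "primitive_on (- pi) pi (\<lambda>t. cis (- p * t)) (\<lambda>t. \<i> * complex_of_real (- p) * cis (- p * t))"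
    by (rule primitive_on_deriv[OF cis_has_vector_derivative]) (intro continuous_intros)
  \<comment> \<open>This is \<open>\<Phi>\<close> divided by the candidate
    \<open>cis (p * t) * exp (U (t - a))\<close>; the first-order equation makes its derivative
    vanish almost everywhere.\<close>
  define H where "H t = \<Phi> t * (cis (- p * t) * complex_of_real (e t))" for t
  have H: "H t = H (- pi)" if "t \<in> {-pi..pi}" for t
    unfolding H_def
  proof (rule primitive_on_constant[OF primitive_on_mult[OF \<Phi>(1) primitive_on_mult[OF Qc Qe]] _ that])
    show "AE t in ?L. g t * (cis (- p * t) * complex_of_real (e t))
        + \<Phi> t * (\<i> * complex_of_real (- p) * cis (- p * t) * complex_of_real (e t)
          + cis (- p * t) * complex_of_real (- v (t - a) * e t)) = 0"
      using ode by eventually_elim (simp add: algebra_simps)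
  qed
  define c where "c = H (- pi)"
  have form: "\<Phi> t = c * cis (p * t) * complex_of_real (exp (U (t - a)))" if "t \<in> {-pi..pi}" for t
  proof -
    have "cis (p * t) * cis (- p * t) = 1" by (simp add: cis_mult)
    moreover have "complex_of_real (exp (U (t - a))) * complex_of_real (e t) = 1"
      by (simp add: e_def exp_minus flip: of_real_mult)
    moreover have "c = \<Phi> t * (cis (- p * t) * complex_of_real (e t))"
      using H[OF that] unfolding c_def by (simp only: H_def)
    then have "c * cis (p * t) * complex_of_real (exp (U (t - a)))
      = \<Phi> t * (cis (p * t) * cis (- p * t)) * (complex_of_real (exp (U (t - a))) * complex_of_real (e t))"
      by (simp only: mult_ac)
    ultimately show ?thesis by simp
  qed
  have "c \<noteq> 0"
  proof
    assume "c = 0"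
    have "AE t in ?L. (cmod (\<phi> t))\<^sup>2 = 0"
      using ae AE_space by eventually_elim (use form \<open>c = 0\<close> in auto)
    then have "(LINT t|?L. (cmod (\<phi> t))\<^sup>2) = 0" by (rule integral_eq_zero_AE)
    then show False using unit_state_norm(3)[OF \<phi>] by simp
  qed
  \<comment> \<open>\<open>\<Phi>\<close> and the translated \<open>U\<close> have equal boundary
    values and \<open>c\<close> is nonzero, so the phase must close up; this quantises
    \<open>p\<close>.\<close>
  have "cis (p * pi) = cis (p * - pi)"
    using form[of pi] form[of "- pi"] \<Phi>(2) S(4) \<open>c \<noteq> 0\<close> by simp
  then have "cis (p * pi) * cis (p * pi) = cis (p * - pi) * cis (p * pi)" by simp
  then have "cis (2 * (p * pi)) = 1" by (simp add: cis_mult mult.commute)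
  then have "cos (2 * (p * pi)) = 1" by (metis cis.sel(1) one_complex.sel(1))
  then obtain k :: int where "2 * (p * pi) = of_int k * 2 * pi" using cos_one_2pi_int by blast
  then have "p = of_int k" by simp
  have "AE t in ?L. \<phi> t = c * cis (of_int k * t) * complex_of_real (exp (U (t - a)))"
    using ae AE_space by eventually_elim (use form \<open>p = of_int k\<close> in auto)
  then show ?thesis by blast
qed

lemma periodic_integral_shift:
  fixes h :: "real \<Rightarrow> real"
  assumes h: "continuous_on UNIV h" and per: "\<And>x. h (x + 2 * pi) = h x"
  shows "integral {-pi..pi} (\<lambda>t. h (t - a)) = integral {-pi..pi} h"
proof -
  obtain F where F: "\<And>x. (F has_real_derivative h x) (at x)"
    using antiderivative_exists[OF h] by blast
  have "((\<lambda>x. F (x + 2 * pi)) has_real_derivative h x) (at x)" for x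
    using deriv_shift_add[OF F, of "2 * pi" x] per by simp
  then have "F (- pi - a + 2 * pi) - F (- pi - a) = F (- pi + 2 * pi) - F (- pi)"
    by (rule same_deriv_diff_constant) (rule F)
  then have c: "F (pi - a) - F (- pi - a) = F pi - F (- pi)" by (simp add: algebra_simps)
  have "((\<lambda>x. F (x - a)) has_real_derivative h (x - a)) (at x)" for x
    using deriv_shift_add[OF F, of "- a" x] by simp
  from integral_unique[OF integral_deriv[OF this, of "- pi" pi]] integral_unique[OF integral_deriv[OF F, of "- pi" pi]] c
  show ?thesis by simp
qed

lemma ground_state_integral_shift:
  fixes h :: "real \<Rightarrow> real"
  assumes gs: "ground_state s U v" and h: "continuous_on UNIV h" "\<And>x. h (x + 2 * pi) = h x"
  shows "(LINT t|circle_measure. h (t - a) * exp (2 * U (t - a))) = integral {-pi..pi} (\<lambda>t. h t * exp (2 * U t))"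
proof -
  note G = ground_stateD[OF gs]
  have hc: "continuous_on S (\<lambda>t. h (t - a))" for S
    by (rule continuous_on_compose2[OF h(1)]) (auto intro!: continuous_intros)
  have "(LINT t|circle_measure. h (t - a) * exp (2 * U (t - a))) = integral {-pi..pi} (\<lambda>t. h (t - a) * exp (2 * U (t - a)))"
    by (intro integral_lebesgue_Icc integrable_lebesgue_Icc_continuous continuous_intros hc ground_state_shift[OF gs])
  also have "\<dots> = integral {-pi..pi} (\<lambda>t. h t * exp (2 * U t))"
    by (rule periodic_integral_shift[where h = "\<lambda>t. h t * exp (2 * U t)"])
      (use G(5) h in \<open>auto intro!: continuous_intros G(9)\<close>)
  finally show ?thesis .
qed

text \<open>The boost \<open>cis (k * t)\<close> only moves the mean momentum to \<open>k\<close>,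
  which centring removes; the translation only rotates the vector of means. So both variances are
  those of \<open>exp U\<close>.\<close>

lemma ground_state_feasible:
  assumes gs: "ground_state s U v" and \<phi>: "unit_state \<phi>"
    and form: "AE t in circle_measure. \<phi> t = c * cis (of_int k * t) * complex_of_real (exp (U (t - a)))"
  shows "\<exists>g. deriv_rep \<phi> g \<and> momentum_var \<phi> g = kinetic U v"
    and "var_cos_sin \<phi> = 1 - (mean_cos U)\<^sup>2"
proof -
  let ?L = circle_measure
  note G = ground_stateD[OF gs] and S = ground_state_shift[OF gs, where a = a]
  note n = unit_state_norm[OF \<phi>]
  define r where "r t = exp (U (t - a))" for t
  have r: "(r has_real_derivative v (t - a) * r t) (at t)" for t
    unfolding r_def by (auto intro!: derivative_eq_intros S)
  define f where "f t = c * cis (of_int k * t) * complex_of_real (r t)" for t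
  define g where "g t = (\<i> * of_int k + complex_of_real (v (t - a))) * f t" for t
  have rc: "continuous_on A r" for A by (rule continuous_on_if_deriv[OF r])
  have fc [continuous_intros]: "continuous_on A f" for A unfolding f_def by (intro continuous_intros rc)
  have gc [continuous_intros]: "continuous_on A g" for A unfolding g_def by (intro continuous_intros S)
  have [measurable]: "f \<in> borel_measurable ?L" "g \<in> borel_measurable ?L" "\<phi> \<in> borel_measurable ?L"
    by (intro continuous_borel_measurable_circle fc gc n)+
  have ae: "AE t in ?L. \<phi> t = f t" using form unfolding f_def r_def .
  have "(f has_vector_derivative g t) (at t)" for t
  proof -
    have "((\<lambda>t. c * cis (of_int k * t)) has_vector_derivative c * (\<i> * complex_of_real (of_int k) * cis (of_int k * t))) (at t)"
      by (intro has_vector_derivative_mult_right cis_has_vector_derivative)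
    moreover have "((\<lambda>t. complex_of_real (r t)) has_vector_derivative complex_of_real (v (t - a) * r t)) (at t)"
      using r[of t] by (intro has_vector_derivative_of_real) (simp add: has_real_derivative_iff_has_vector_derivative)
    ultimately have "(f has_vector_derivative (c * cis (of_int k * t)) * complex_of_real (v (t - a) * r t)
        + c * (\<i> * complex_of_real (of_int k) * cis (of_int k * t)) * complex_of_real (r t)) (at t)"
      unfolding f_def by (rule has_vector_derivative_mult)
    then show ?thesis unfolding g_def f_def by (simp add: algebra_simps)
  qed
  then have prim: "primitive_on (- pi) pi f g" by (rule primitive_on_deriv) (rule gc)
  have per: "f pi = f (- pi)"
  proof -
    have "sin (pi * of_int k) = 0" using sin_zero_iff_int2 by (metis mult.commute)
    then have "cis (of_int k * pi) = cis (of_int k * - pi)" by (simp add: complex_eq_iff mult.commute)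
    then show ?thesis using S(4) unfolding f_def r_def by simp
  qed
  have rep: "deriv_rep \<phi> g"
    unfolding deriv_rep_def LINT_lebesgue_Icc AE_lebesgue_Icc[symmetric]
  proof (intro conjI exI)
    show "L2p g" unfolding L2p_iff by (intro conjI continuous_borel_measurable_circle integrable_lebesgue_Icc_continuous continuous_intros)
    show "integral\<^sup>L ?L g = 0" using primitive_on_end[OF prim] per by simp
    show "AE t in ?L. \<phi> t = f (- pi) + integral\<^sup>L (lebesgue_Icc (- pi) t) g"
      using ae AE_space
    proof eventually_elim
      case (elim t)
      then have "t \<in> {-pi..pi}" by simp
      with prim have "f t = f (- pi) + integral\<^sup>L (lebesgue_Icc (- pi) t) g"
        unfolding primitive_on_def by blast
      with elim show ?case by simp
    qed
  qed
  have f2: "(cmod (f t))\<^sup>2 = (cmod c)\<^sup>2 * exp (2 * U (t - a))" for t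
    unfolding f_def r_def by (simp add: norm_mult power_mult_distrib exp_double)
  have expect: "(LINT t|?L. h (t - a) * (cmod (\<phi> t))\<^sup>2) = (cmod c)\<^sup>2 * integral {-pi..pi} (\<lambda>t. h t * exp (2 * U t))"
    if h: "continuous_on UNIV h" "\<And>x. h (x + 2 * pi) = h x" for h :: "real \<Rightarrow> real"
  proof -
    have "continuous_on {-pi..pi} (\<lambda>t. h (t - a))"
      by (rule continuous_on_compose2[OF h(1)]) (auto intro!: continuous_intros)
    then have [measurable]: "(\<lambda>t. h (t - a)) \<in> borel_measurable ?L" by (rule continuous_borel_measurable_circle)
    have "(LINT t|?L. h (t - a) * (cmod (\<phi> t))\<^sup>2) = (LINT t|?L. h (t - a) * (cmod (f t))\<^sup>2)"
      by (rule integral_cong_AE) (measurable, use ae in \<open>eventually_elim, simp\<close>)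
    also have "\<dots> = (LINT t|?L. (cmod c)\<^sup>2 * (h (t - a) * exp (2 * U (t - a))))"
      unfolding f2 by (simp only: mult_ac)
    also have "\<dots> = (cmod c)\<^sup>2 * (LINT t|?L. h (t - a) * exp (2 * U (t - a)))"
      by simp
    finally show ?thesis unfolding ground_state_integral_shift[OF gs h] .
  qed
  \<comment> \<open>The modulus of \<open>c\<close> is forced by the normalisation of
    \<open>\<phi>\<close> and of the ground state.\<close>
  have c1: "(cmod c)\<^sup>2 = 1" using expect[of "\<lambda>_. 1"] n(3) G(8) by simp
  have f_norm: "(LINT t|?L. (cmod (f t))\<^sup>2) = 2 * pi"
  proof -
    have "(LINT t|?L. (cmod (f t))\<^sup>2) = (LINT t|?L. (cmod (\<phi> t))\<^sup>2)"
      by (rule integral_cong_AE) (measurable, use ae in \<open>eventually_elim, simp\<close>)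
    then show ?thesis using n(3) by simp
  qed
  have p: "Re (ip \<phi> (\<lambda>t. - \<i> * g t)) = of_int k"
  proof -
    have [measurable]: "(\<lambda>t. cnj (\<phi> t)) \<in> borel_measurable ?L" "(\<lambda>t. cnj (f t)) \<in> borel_measurable ?L"
      by (rule borel_measurable_continuous_on[OF continuous_on_cnj[OF continuous_on_id]]; measurable)+
    have "(LINT t|?L. cnj (\<phi> t) * (- \<i> * g t)) = (LINT t|?L. cnj (f t) * (- \<i> * g t))"
      by (rule integral_cong_AE) (measurable, use ae in \<open>eventually_elim, simp\<close>)
    moreover have "Re (LINT t|?L. cnj (f t) * (- \<i> * g t)) = (LINT t|?L. Re (cnj (f t) * (- \<i> * g t)))"
      by (rule integral_Re[symmetric]) (intro integrable_lebesgue_Icc_continuous continuous_intros)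
    moreover have "Re (cnj (f t) * (- \<i> * g t)) = of_int k * (cmod (f t))\<^sup>2" for t
      unfolding g_def cmod_power2 by (simp add: power2_eq_square algebra_simps)
    ultimately have "Re (LINT t|?L. cnj (\<phi> t) * (- \<i> * g t)) = of_int k * (2 * pi)"
      using f_norm by simp
    then show ?thesis unfolding ip_def LINT_lebesgue_Icc by (simp only: Re_divide_of_real) simp
  qed
  have "(LINT t|?L. (cmod (- \<i> * g t - complex_of_real (of_int k) * \<phi> t))\<^sup>2)
     = (LINT t|?L. (v (t - a))\<^sup>2 * exp (2 * U (t - a)))"
  proof (rule integral_cong_AE)
    have [measurable]: "(\<lambda>t. v (t - a)) \<in> borel_measurable ?L" "(\<lambda>t. U (t - a)) \<in> borel_measurable ?L"
      by (intro continuous_borel_measurable_circle S)+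
    show "(\<lambda>t. (cmod (- \<i> * g t - complex_of_real (of_int k) * \<phi> t))\<^sup>2) \<in> borel_measurable ?L"
      "(\<lambda>t. (v (t - a))\<^sup>2 * exp (2 * U (t - a))) \<in> borel_measurable ?L"
      by measurable
    show "AE t in ?L. (cmod (- \<i> * g t - complex_of_real (of_int k) * \<phi> t))\<^sup>2 = (v (t - a))\<^sup>2 * exp (2 * U (t - a))"
      using ae
    proof eventually_elim
      case (elim t)
      have "- \<i> * g t - complex_of_real (of_int k) * \<phi> t = - \<i> * complex_of_real (v (t - a)) * f t"
        unfolding elim g_def by (simp add: algebra_simps)
      then show ?case using f2[of t] c1 by (simp add: norm_mult power_mult_distrib)
    qed
  qed
  also have "\<dots> = 2 * pi * kinetic U v"
    using ground_state_integral_shift[OF gs, of "\<lambda>t. (v t)\<^sup>2" a] G(7) unfolding kinetic_def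
    by (simp add: continuous_on_power G(10))
  finally have "momentum_var \<phi> g = kinetic U v"
    unfolding momentum_var_def Let_def p LINT_lebesgue_Icc by simp
  with rep show "\<exists>g. deriv_rep \<phi> g \<and> momentum_var \<phi> g = kinetic U v" by blast
  have e1: "cos a * expect_mult cos \<phi> + sin a * expect_mult sin \<phi> = mean_cos U"
    using expect[OF continuous_on_cos[OF continuous_on_id] cos_periodic] c1 expect_cos_shift(2)[OF \<phi>, of a]
    unfolding mean_cos_def by (simp add: field_simps)
  have odd: "integral {-pi..pi} (\<lambda>t. sin t * exp (2 * U t)) = 0"
  proof -
    have "integral {-pi..pi} (\<lambda>t. sin (- t) * exp (2 * U (- t))) = integral {-pi..pi} (\<lambda>t. sin t * exp (2 * U t))"
      using Henstock_Kurzweil_Integration.integral_reflect_real[of pi "- pi" "\<lambda>t. sin t * exp (2 * U t)"] by simp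
    then show ?thesis using G(4) by simp
  qed
  have e2: "- sin a * expect_mult cos \<phi> + cos a * expect_mult sin \<phi> = 0"
  proof -
    \<comment> \<open>The shift formula at \<open>a + pi / 2\<close> supplies the mean perpendicular
      to the rotated axis; it vanishes because \<open>U\<close> is even.\<close>
    have "(LINT t|?L. cos (t - (a + pi / 2)) * (cmod (\<phi> t))\<^sup>2) = (LINT t|?L. sin (t - a) * (cmod (\<phi> t))\<^sup>2)"
      by (intro Bochner_Integration.integral_cong refl) (simp add: cos_diff sin_diff cos_add sin_add)
    also have "\<dots> = 0" using expect[OF continuous_on_sin[OF continuous_on_id] sin_periodic] odd by simp
    finally show ?thesis
      using expect_cos_shift(2)[OF \<phi>, of "a + pi / 2"] by (simp add: cos_add sin_add)
  qed
  define x where "x = expect_mult cos \<phi>"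
  define y where "y = expect_mult sin \<phi>"
  have "x\<^sup>2 + y\<^sup>2 = ((sin a)\<^sup>2 + (cos a)\<^sup>2) * (x\<^sup>2 + y\<^sup>2)" by simp
  also have "\<dots> = (cos a * x + sin a * y)\<^sup>2 + (- sin a * x + cos a * y)\<^sup>2"
    by algebra
  also have "\<dots> = (mean_cos U)\<^sup>2" using e1 e2 unfolding x_def y_def by simp
  finally show "var_cos_sin \<phi> = 1 - (mean_cos U)\<^sup>2"
    unfolding var_cos_sin_eq[OF \<phi>] x_def y_def by simp
qed

lemma ground_state_unit_state:
  assumes gs: "ground_state s U v"
  shows "unit_state (\<lambda>t. complex_of_real (exp (U t)))"
proof -
  note G = ground_stateD[OF gs]
  have "L2p (\<lambda>t. complex_of_real (exp (U t)))"
    unfolding L2p_iff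
    by (intro conjI continuous_borel_measurable_circle integrable_lebesgue_Icc_continuous continuous_intros G(9))
  moreover have "ip (\<lambda>t. complex_of_real (exp (U t))) (\<lambda>t. complex_of_real (exp (U t))) = 1"
  proof -
    have "(LINT t|circle_measure. cnj (complex_of_real (exp (U t))) * complex_of_real (exp (U t)))
      = (LINT t|circle_measure. complex_of_real (exp (2 * U t)))"
      by (simp add: exp_double power2_eq_square)
    also have "\<dots> = complex_of_real (LINT t|circle_measure. exp (2 * U t))" by (rule integral_complex_of_real)
    also have "(LINT t|circle_measure. exp (2 * U t)) = 2 * pi"
      unfolding G(8)[symmetric]
      by (intro integral_lebesgue_Icc integrable_lebesgue_Icc_continuous continuous_intros G(9))
    finally show ?thesis unfolding ip_def LINT_lebesgue_Icc by simp
  qed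
  ultimately show ?thesis unfolding unit_state_def by simp
qed

section \<open>Duality and the characterisation of the minimisers\<close>

theorem theorem10:
  fixes E :: real
  assumes "E > 0"
  shows "\<exists>M.
     (\<exists>s>0. bound_fun E s = M) \<and> (\<forall>s>0. bound_fun E s \<le> M) \<and>
     (\<exists>\<phi>. feasible E \<phi> \<and> var_cos_sin \<phi> = M) \<and>
     (\<forall>\<phi>. feasible E \<phi> \<longrightarrow> M \<le> var_cos_sin \<phi>) \<and>
     (\<exists>!sE. sE > 0 \<and> (\<forall>s>0. sE_fun E s \<le> sE_fun E sE)) \<and>
     (\<forall>sE. sE > 0 \<and> (\<forall>s>0. sE_fun E s \<le> sE_fun E sE) \<longrightarrow>
        (\<forall>\<phi>. unit_state \<phi> \<longrightarrow>
           ((feasible E \<phi> \<and> var_cos_sin \<phi> = M) \<longleftrightarrow>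
            (\<exists>y c \<theta>0 (k::int). mathieu_even_sol (mathieu_a0 (- 2 / sE)) (- 2 / sE) y \<and>
               (AE \<theta> in lebesgue. \<theta> \<in> {-pi..pi} \<longrightarrow>
                  \<phi> \<theta> = c * cis (of_int k * \<theta>) * complex_of_real (y ((\<theta> - \<theta>0) / 2)))))))"
proof -
  obtain s U0 v0 where gs0: "ground_state s U0 v0" and kin0: "kinetic U0 v0 = E"
    using optimal_coupling_exists[OF assms] by blast
  have s: "s > 0" using ground_stateD(1)[OF gs0] .
  obtain U v where gs: "ground_state s U v"
    and sol: "mathieu_even_sol (mathieu_a0 (- 2 / s)) (- 2 / s) (\<lambda>x. exp (U (2 * x)))"
    and uniq: "\<And>y. mathieu_even_sol (mathieu_a0 (- 2 / s)) (- 2 / s) y \<Longrightarrow> \<exists>c. \<forall>x. y x = c * exp (U (2 * x))"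
    by (rule ground_state_mathieu[OF s]) blast
  \<comment> \<open>The ground state built from the Mathieu function and the one found by
    optimisation are compared only through the derivative of \<open>energy\<close> at
    \<open>s\<close>, which is the kinetic energy of both.\<close>
  have kin: "kinetic U v = E"
    using DERIV_unique[OF energy_has_derivative[OF gs] energy_has_derivative[OF gs0]] kin0 by simp
  define C where "C = mean_cos U"
  have C: "C = s * E - energy s" unfolding C_def using ground_energy[OF gs] kin by simp
  then have Cpos: "C > 0" using energy_nonpos[OF s] mult_pos_pos[OF s assms] by linarith
  have bf: "bound_fun E r = 1 - (r * E - energy r)\<^sup>2" for r unfolding bound_fun_def energy_def ..
  have sf: "sE_fun E r = 1 - (r * E - energy r)" for r unfolding sE_fun_def energy_def by simp
  \<comment> \<open>The tangent of \<open>energy\<close> at \<open>s\<close> has slope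
    \<open>E\<close>, so strict concavity makes \<open>s\<close> the unique minimiser of
    \<open>r * E - energy r\<close>, with value \<open>C\<close>.\<close>
  have strict: "C < r * E - energy r" if "r > 0" "r \<noteq> s" for r
    using energy_strictly_below_tangent[OF gs that] unfolding kin C by (simp add: algebra_simps)
  have le: "C \<le> r * E - energy r" if "r > 0" for r
    using strict[OF that] C by (cases "r = s") auto
  have max: "sE_fun E r \<le> sE_fun E s" if "r > 0" for r using le[OF that] unfolding sf C by simp
  have argmax: "sE = s" if "sE > 0" "\<forall>r>0. sE_fun E r \<le> sE_fun E sE" for sE
  proof (rule ccontr)
    assume "sE \<noteq> s"
    with strict[OF that(1)] that(2) s show False unfolding sf C by force
  qed
  define R where "R \<phi> = sqrt ((expect_mult cos \<phi>)\<^sup>2 + (expect_mult sin \<phi>)\<^sup>2)" for \<phi>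
  have R: "R \<phi> \<ge> 0" "var_cos_sin \<phi> = 1 - (R \<phi>)\<^sup>2" if "unit_state \<phi>" for \<phi>
    using var_cos_sin_eq[OF that] unfolding R_def by simp_all
  have bound: "\<exists>a p. R \<phi> + s / (2 * pi) * (LINT t|circle_measure. (cmod (g t - (\<i> * complex_of_real p + complex_of_real (v (t - a))) * \<phi> t))\<^sup>2) \<le> C"
    if "unit_state \<phi>" "deriv_rep \<phi> g" "momentum_var \<phi> g \<le> E" for \<phi> g
    using state_bound[OF gs kin that] unfolding R_def C_def .
  have lower: "1 - C\<^sup>2 \<le> var_cos_sin \<phi>" if f: "feasible E \<phi>" for \<phi>
  proof -
    obtain g where u: "unit_state \<phi>" and g: "deriv_rep \<phi> g" "momentum_var \<phi> g \<le> E"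
      using f unfolding feasible_def by blast
    obtain a p where b: "R \<phi> + s / (2 * pi) * (LINT t|circle_measure. (cmod (g t - (\<i> * complex_of_real p + complex_of_real (v (t - a))) * \<phi> t))\<^sup>2) \<le> C"
      using bound[OF u g] by blast
    moreover have "0 \<le> s / (2 * pi) * (LINT t|circle_measure. (cmod (g t - (\<i> * complex_of_real p + complex_of_real (v (t - a))) * \<phi> t))\<^sup>2)"
      using s by simp
    ultimately have "R \<phi> \<le> C" by linarith
    then show ?thesis using R[OF u] by (simp add: power_mono)
  qed
  have half: "2 * ((x - y) / 2) = x - y" for x y :: real by simp
  have iff: "(feasible E \<phi> \<and> var_cos_sin \<phi> = 1 - C\<^sup>2) \<longleftrightarrow>
      (\<exists>y c \<theta>0 (k::int). mathieu_even_sol (mathieu_a0 (- 2 / s)) (- 2 / s) y \<and>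
         (AE \<theta> in lebesgue. \<theta> \<in> {-pi..pi} \<longrightarrow>
            \<phi> \<theta> = c * cis (of_int k * \<theta>) * complex_of_real (y ((\<theta> - \<theta>0) / 2))))"
    (is "?opt \<longleftrightarrow> ?form") if u: "unit_state \<phi>" for \<phi>
  proof
    assume opt: ?opt
    then obtain g where g: "deriv_rep \<phi> g" "momentum_var \<phi> g \<le> E" unfolding feasible_def by blast
    obtain a p where b: "R \<phi> + s / (2 * pi) * (LINT t|circle_measure. (cmod (g t - (\<i> * complex_of_real p + complex_of_real (v (t - a))) * \<phi> t))\<^sup>2) \<le> C"
      using bound[OF u g] by blast
    have "(R \<phi>)\<^sup>2 = C\<^sup>2" using opt R(2)[OF u] by simp
    then have "R \<phi> = C" using R(1)[OF u] Cpos by simp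
    \<comment> \<open>With \<open>R \<phi> = C\<close> the bound leaves no room for its nonnegative
      remainder.\<close>
    define J where "J = (LINT t|circle_measure. (cmod (g t - (\<i> * complex_of_real p + complex_of_real (v (t - a))) * \<phi> t))\<^sup>2)"
    have "J \<ge> 0" unfolding J_def by simp
    moreover have "s / (2 * pi) * J \<le> 0" using b \<open>R \<phi> = C\<close> unfolding J_def by simp
    ultimately have "J = 0" using s by (smt (verit) divide_pos_pos mult_pos_pos pi_gt_zero)
    then obtain c and k :: int where ae: "AE t in circle_measure. \<phi> t = c * cis (of_int k * t) * complex_of_real (exp (U (t - a)))"
      using equality_form[OF gs u g(1)] unfolding J_def by blast
    show ?form
      by (rule exI[of _ "\<lambda>x. exp (U (2 * x))"], rule exI[of _ c], rule exI[of _ a], rule exI[of _ k])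
        (unfold half AE_lebesgue_Icc[symmetric], use sol ae in blast)
  next
    assume ?form
    then obtain y c a and k :: int where y: "mathieu_even_sol (mathieu_a0 (- 2 / s)) (- 2 / s) y"
      and ae: "AE t in circle_measure. \<phi> t = c * cis (of_int k * t) * complex_of_real (y ((t - a) / 2))"
      unfolding AE_lebesgue_Icc by blast
    \<comment> \<open>Uniqueness replaces any admissible \<open>y\<close> by \<open>exp U\<close>,
      the factor \<open>d\<close> being absorbed into \<open>c\<close>.\<close>
    obtain d where d: "\<And>x. y x = d * exp (U (2 * x))" using uniq[OF y] by blast
    have form: "AE t in circle_measure. \<phi> t = (c * complex_of_real d) * cis (of_int k * t) * complex_of_real (exp (U (t - a)))"
      using ae by eventually_elim (simp only: d half of_real_mult mult_ac)
    show ?opt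
      using ground_state_feasible[OF gs u form] u kin unfolding feasible_def C_def by force
  qed
  define \<phi>0 where "\<phi>0 t = complex_of_real (exp (U t))" for t
  have u0: "unit_state \<phi>0" unfolding \<phi>0_def by (rule ground_state_unit_state[OF gs])
  have "AE t in circle_measure. \<phi>0 t = 1 * cis (of_int 0 * t) * complex_of_real (exp (U (t - 0)))"
    unfolding \<phi>0_def by simp
  note gf = ground_state_feasible[OF gs u0 this]
  have attained: "feasible E \<phi>0" "var_cos_sin \<phi>0 = 1 - C\<^sup>2"
    using gf u0 unfolding feasible_def C_def kin by auto
  show ?thesis
  proof (rule exI[of _ "1 - C\<^sup>2"], intro conjI)
    show "\<exists>r>0. bound_fun E r = 1 - C\<^sup>2" using s unfolding bf C by blast
    \<comment> \<open>Since \<open>r * E - energy r \<ge> C > 0\<close>, squaring preserves the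
      order.\<close>
    show "\<forall>r>0. bound_fun E r \<le> 1 - C\<^sup>2"
      unfolding bf using le Cpos by (simp add: power_mono)
    show "\<exists>\<phi>. feasible E \<phi> \<and> var_cos_sin \<phi> = 1 - C\<^sup>2" using attained by blast
    show "\<forall>\<phi>. feasible E \<phi> \<longrightarrow> 1 - C\<^sup>2 \<le> var_cos_sin \<phi>" using lower by blast
    show "\<exists>!sE. sE > 0 \<and> (\<forall>r>0. sE_fun E r \<le> sE_fun E sE)"
    proof (rule ex1I[of _ s])
      show "s > 0 \<and> (\<forall>r>0. sE_fun E r \<le> sE_fun E s)" using s max by blast
      show "sE = s" if "sE > 0 \<and> (\<forall>r>0. sE_fun E r \<le> sE_fun E sE)" for sE
        using that by (intro argmax) auto
    qed
    show "\<forall>sE. sE > 0 \<and> (\<forall>s>0. sE_fun E s \<le> sE_fun E sE) \<longrightarrow>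
        (\<forall>\<phi>. unit_state \<phi> \<longrightarrow>
           ((feasible E \<phi> \<and> var_cos_sin \<phi> = 1 - C\<^sup>2) \<longleftrightarrow>
            (\<exists>y c \<theta>0 (k::int). mathieu_even_sol (mathieu_a0 (- 2 / sE)) (- 2 / sE) y \<and>
               (AE \<theta> in lebesgue. \<theta> \<in> {-pi..pi} \<longrightarrow>
                  \<phi> \<theta> = c * cis (of_int k * \<theta>) * complex_of_real (y ((\<theta> - \<theta>0) / 2))))))"
    proof (intro allI impI)
      fix sE \<phi> assume "sE > 0 \<and> (\<forall>s>0. sE_fun E s \<le> sE_fun E sE)" and u: "unit_state \<phi>"
      then have "sE = s" by (intro argmax) auto
      show "(feasible E \<phi> \<and> var_cos_sin \<phi> = 1 - C\<^sup>2) \<longleftrightarrow>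
            (\<exists>y c \<theta>0 (k::int). mathieu_even_sol (mathieu_a0 (- 2 / sE)) (- 2 / sE) y \<and>
               (AE \<theta> in lebesgue. \<theta> \<in> {-pi..pi} \<longrightarrow>
                  \<phi> \<theta> = c * cis (of_int k * \<theta>) * complex_of_real (y ((\<theta> - \<theta>0) / 2))))"
        unfolding \<open>sE = s\<close> by (rule iff[OF u])
    qed
  qed
qed

end
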